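(* Any symmetric, log-concave product probability measure $\mu=\mu_1\otimes\cdots\otimes\mu_n$ on $\mathbb{R}^n$ (each $\mu_i$ a probability measure on $\mathbb{R}$) satisfies $\mathrm{IC}(48)$.
   Context: A measure $\mu$ on $\mathbb{R}^n$ is log-concave if $\mu(tA+(1-t)B)\ge\mu(A)^t\mu(B)^{1-t}$ for all nonempty compact sets $A,B$ and $t\in[0,1]$; it is symmetric if $\mu(-A)=\mu(A)$ for Borel $A$. For functions $f,g$ on $\mathbb{R}^n$, $f\Box g(x):=\inf\{f(x-y)+g(y): y\in\mathbb{R}^n\}$. For a probability measure $\mu$ on $\mathbb{R}^n$ and a measurable $\varphi:\mathbb{R}^n\to[0,\infty]$, the pair $(\mu,\varphi)$ has property $(\tau)$ if for every bounded measurable $f:\mathbb{R}^n\to\mathbb{R}$, $\int e^{f\Box\varphi}\,d\mu\int e^{-f}\,d\mu\le 1$. Put $\Lambda_\mu(v)=\log\int_{\mathbb{R}^n}e^{\langle v,x\rangle}d\mu(x)$ and $\Lambda_\mu^\star(v)=\sup_{u\in\mathbb{R}^n}\{\langle v,u\rangle-\Lambda_\mu(u)\}$. A symmetric probability measure $\mu$ satisfies $\mathrm{IC}(\beta)$, $\beta>0$, if the pair $(\mu,\Lambda_\mu^\star(\cdot/\beta))$ has property $(\tau)$. *)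

theory Defs
  imports "HOL-Probability.Probability"
begin

text \<open>The real-valued \<^const>\<open>measure\<close> is adequate because the definition is only applied to
  probability measures.  For \<open>t \<in> {0, 1}\<close> the library has \<open>0 powr 0 = 0\<close> rather than \<open>1\<close>;
  with either value the inequality holds trivially at these endpoints.\<close>

definition log_concave_measure :: "'a::euclidean_space measure \<Rightarrow> bool" where
  "log_concave_measure M \<longleftrightarrow>
     (\<forall>A B. \<forall>t\<in>{0..1::real}. compact A \<and> A \<noteq> {} \<and> compact B \<and> B \<noteq> {} \<longrightarrow>
        measure M {t *\<^sub>R a + (1 - t) *\<^sub>R b | a b. a \<in> A \<and> b \<in> B}
          \<ge> measure M A powr t * measure M B powr (1 - t))"

definition symmetric_measure :: "'a::euclidean_space measure \<Rightarrow> bool" where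
  "symmetric_measure M \<longleftrightarrow> (\<forall>A\<in>sets borel. emeasure M (uminus ` A) = emeasure M A)"

definition inf_convolution ::
    "('a::euclidean_space \<Rightarrow> ereal) \<Rightarrow> ('a \<Rightarrow> ereal) \<Rightarrow> 'a \<Rightarrow> ereal" where
  "inf_convolution f g x = (INF y. f (x - y) + g y)"

definition exp_ereal :: "ereal \<Rightarrow> ennreal" where
  "exp_ereal x =
     (if x = \<infinity> then \<top> else if x = -\<infinity> then 0 else ennreal (exp (real_of_ereal x)))"

definition ln_ennreal :: "ennreal \<Rightarrow> ereal" where
  "ln_ennreal x = (if x = 0 then -\<infinity> else if x = \<top> then \<infinity> else ereal (ln (enn2real x)))"

text \<open>The infimum convolution of Borel functions need not be Borel, but its sublevel sets are
  analytic, so it is measurable for the completion of \<open>M\<close>; hence the first integral is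
  taken with respect to \<^term>\<open>completion M\<close>.\<close>

definition property_tau :: "'a::euclidean_space measure \<Rightarrow> ('a \<Rightarrow> ereal) \<Rightarrow> bool" where
  "property_tau M \<phi> \<longleftrightarrow>
     prob_space M \<and> sets M = sets borel \<and>
     \<phi> \<in> borel_measurable borel \<and> (\<forall>x. 0 \<le> \<phi> x) \<and>
     (\<forall>f::'a \<Rightarrow> real. f \<in> borel_measurable borel \<and> bounded (range f) \<longrightarrow>
        (\<integral>\<^sup>+ x. exp_ereal (inf_convolution (\<lambda>y. ereal (f y)) \<phi> x) \<partial>completion M)
          * (\<integral>\<^sup>+ x. ennreal (exp (- f x)) \<partial>M) \<le> 1)"

definition log_laplace :: "'a::euclidean_space measure \<Rightarrow> 'a \<Rightarrow> ereal" where
  "log_laplace M v = ln_ennreal (\<integral>\<^sup>+ x. ennreal (exp (v \<bullet> x)) \<partial>M)"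

definition legendre_log_laplace :: "'a::euclidean_space measure \<Rightarrow> 'a \<Rightarrow> ereal" where
  "legendre_log_laplace M v = (SUP u. ereal (v \<bullet> u) - log_laplace M u)"

definition IC :: "'a::euclidean_space measure \<Rightarrow> real \<Rightarrow> bool" where
  "IC M \<beta> \<longleftrightarrow> 0 < \<beta> \<and> symmetric_measure M \<and>
     property_tau M (\<lambda>v. legendre_log_laplace M (v /\<^sub>R \<beta>))"

text \<open>\<^const>\<open>PiM\<close> lives on functions; it is transported to \<open>real ^ 'n\<close>.\<close>

definition product_measure :: "('n::finite \<Rightarrow> real measure) \<Rightarrow> (real ^ 'n) measure" where
  "product_measure \<mu> = distr (PiM UNIV \<mu>) borel (\<lambda>x. \<chi> i. x i)"

lemma emeasure_product_measure:
  fixes \<mu> :: "'n::finite \<Rightarrow> real measure"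
  assumes "\<And>i. prob_space (\<mu> i)" "\<And>i. sets (\<mu> i) = sets borel" "\<And>i. A i \<in> sets borel"
  shows "emeasure (product_measure \<mu>) {x. \<forall>i. x $ i \<in> A i} = (\<Prod>i\<in>UNIV. emeasure (\<mu> i) (A i))"
proof -
  interpret product_sigma_finite \<mu>
    unfolding product_sigma_finite_def by (simp add: assms(1) prob_space_imp_sigma_finite)
  have sp: "space (\<mu> i) = UNIV" for i
    using sets_eq_imp_space_eq[OF assms(2)[of i]] by simp
  have m: "(\<lambda>x. \<chi> i. x i) \<in> PiM UNIV \<mu> \<rightarrow>\<^sub>M borel"
  proof (subst borel_measurable_euclidean_space, intro ballI)
    fix b :: "real ^ 'n" assume "b \<in> Basis"
    then obtain i where b: "b = axis i 1" by (auto simp: Basis_vec_def)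
    have "(\<lambda>x. x i) \<in> PiM UNIV \<mu> \<rightarrow>\<^sub>M \<mu> i" by (rule measurable_component_singleton) simp
    then have "(\<lambda>x. x i) \<in> borel_measurable (PiM UNIV \<mu>)"
      by (simp only: measurable_cong_sets[OF refl assms(2)])
    then show "(\<lambda>x. (\<chi> i. x i) \<bullet> b) \<in> borel_measurable (PiM UNIV \<mu>)"
      by (simp add: b inner_axis)
  qed
  have "{x. x $ i \<in> A i} \<in> sets (borel :: (real ^ 'n) measure)" for i
    using measurable_sets_borel[OF borel_measurable_nth[of i] assms(3)[of i]]
    by (simp add: vimage_def)
  then have s: "{x. \<forall>i. x $ i \<in> A i} \<in> sets (borel :: (real ^ 'n) measure)"
    using sets.finite_INT[of UNIV "\<lambda>i. {x. x $ i \<in> A i}" "borel :: (real ^ 'n) measure"]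
    by (simp add: Collect_all_eq)
  have "(\<lambda>x. \<chi> i. x i) -` {x. \<forall>i. x $ i \<in> A i} \<inter> space (PiM UNIV \<mu>) = PiE UNIV A"
    by (auto simp: space_PiM sp PiE_def)
  then show ?thesis
    unfolding product_measure_def
    by (simp add: emeasure_distr[OF m s] emeasure_PiM assms(2,3))
qed

end

theory Submission
  imports Defs
begin

text \<open>
  The inequality of property \<open>(\<tau>)\<close> is used in a form with two functions and no infimum: if
  \<open>H x * F y \<le> K x y\<close> for all points, then \<open>(\<integral>H) (\<integral>F) \<le> 1\<close>. With \<open>H\<close> below \<open>exp\<close> of an infimum
  convolution, \<open>F = exp (- f)\<close> and \<open>K x y = exp (\<phi> (x - y))\<close> it gives property \<open>(\<tau>)\<close>
  (\<open>property_tau_two_function\<close>). In this form the inequality passes to products by Fubini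
  (\<open>two_function_tau_pair\<close>, \<open>two_function_tau_PiM\<close>) and to images under any map that does not increase
  the cost (\<open>two_function_tau_distr\<close>), and no infimum convolution has to be measurable.

  The source of the inequality is the exponential measure on the half-line, for the cost
  \<open>(sqrt (1 + d\<^sup>2) - 1) / 10\<close> (\<open>exponential_tau\<close>). As in transport proofs of the Prekopa-Leindler
  inequality, one transports \<open>exp (h x - x)\<close> to \<open>exp (- f y - y)\<close> by a monotone map \<open>y\<close> and compares the
  mass swept by an intermediate point. The exponential density is log-affine, so the midpoint of
  \<open>x\<close> and \<open>y x\<close> gains nothing; the midpoint moved slightly towards the origin, by an amount depending
  only on \<open>x - y x\<close>, gains enough (\<open>exp_transport_interval\<close>).

  A symmetric log-concave probability measure on the line is either the point mass at the origin or
  has no atoms. It is the image of two independent exponential variables \<open>X, Y\<close> under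
  \<open>transport (X - Y)\<close>, with a monotone map \<open>transport\<close> from the Laplace distribution. Log-concavity of
  the tail \<open>x \<mapsto> \<mu> [x, \<infinity>)\<close> controls the increments of this map: if \<open>s - r = 2 * u\<close>, then half of the
  increment from \<open>r\<close> to \<open>s\<close> is a point \<open>z\<close> with \<open>\<mu> [z, \<infinity>) \<ge> exp (- u) / 2\<close>
  (\<open>tail_half_transport_difference\<close>). A tail that is large at \<open>z\<close> makes the Laplace transform large, hence
  its Legendre transform small: \<open>\<Lambda>\<^sup>\<star> (z / 24) \<le> (sqrt (1 + u\<^sup>2) - 1) / 5\<close>
  (\<open>exp_le_rate_mult_laplace\<close>). For \<open>u \<ge> 1\<close> the mass beyond \<open>z\<close> suffices; for \<open>u < 1\<close> log-concavity and
  symmetry put mass at least \<open>1 / 2\<close> outside \<open>(- z / (3 * u), z / (3 * u))\<close>, which makes the Laplace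
  transform grow quadratically near the origin. The right-hand side is at most the cost for the pair
  \<open>(X, Y)\<close>, so the image measure satisfies the inequality with the cost \<open>\<Lambda>\<^sup>\<star> (\<sqdot> / 48)\<close>
  (\<open>two_function_tau_legendre\<close>); the factor \<open>48\<close> is \<open>2 * 24\<close>, since \<open>z\<close> is half of the increment.

  Finally, the marginals of a symmetric log-concave product measure are symmetric and log-concave, and
  the Legendre transform of the product is at most the sum of those of the factors
  (\<open>exp_legendre_product_le\<close>), so the one-dimensional inequalities multiply to the claim.
\<close>

section \<open>A two-function form of property (tau)\<close>

text \<open>Property \<open>(\<tau>)\<close> for a kernel \<open>K\<close> that plays the role of \<open>exp (\<phi> (x - y))\<close>. Kernel and test functions take
values in the extended nonnegative reals, so neither boundedness nor integrability is ever in question.\<close>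

definition two_function_tau :: "'a measure \<Rightarrow> ('a \<Rightarrow> 'a \<Rightarrow> ennreal) \<Rightarrow> bool" where
  "two_function_tau M K \<longleftrightarrow>
     (\<forall>H\<in>borel_measurable M. \<forall>F\<in>borel_measurable M.
        (\<forall>x\<in>space M. \<forall>y\<in>space M. H x * F y \<le> K x y) \<longrightarrow>
        (\<integral>\<^sup>+ x. H x \<partial>M) * (\<integral>\<^sup>+ y. F y \<partial>M) \<le> 1)"

lemma two_function_tauI:
  assumes "\<And>H F. H \<in> borel_measurable M \<Longrightarrow> F \<in> borel_measurable M \<Longrightarrow>
     (\<And>x y. x \<in> space M \<Longrightarrow> y \<in> space M \<Longrightarrow> H x * F y \<le> K x y) \<Longrightarrow>
     (\<integral>\<^sup>+ x. H x \<partial>M) * (\<integral>\<^sup>+ y. F y \<partial>M) \<le> 1"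
  shows "two_function_tau M K"
  using assms unfolding two_function_tau_def by blast

lemma two_function_tauD:
  assumes "two_function_tau M K" "H \<in> borel_measurable M" "F \<in> borel_measurable M"
    and "\<And>x y. x \<in> space M \<Longrightarrow> y \<in> space M \<Longrightarrow> H x * F y \<le> K x y"
  shows "(\<integral>\<^sup>+ x. H x \<partial>M) * (\<integral>\<^sup>+ y. F y \<partial>M) \<le> 1"
  using assms unfolding two_function_tau_def by blast

text \<open>The inequality is homogeneous, so a kernel inflated by a constant only inflates the bound. This is how the
kernel of the second factor enters when the first factor is integrated out.\<close>

lemma two_function_tau_scaled:
  assumes tau: "two_function_tau M K"
    and [measurable]: "H \<in> borel_measurable M" "F \<in> borel_measurable M"
    and le: "\<And>x y. x \<in> space M \<Longrightarrow> y \<in> space M \<Longrightarrow> H x * F y \<le> K x y * c"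
    and c: "c \<noteq> 0"
  shows "(\<integral>\<^sup>+ x. H x \<partial>M) * (\<integral>\<^sup>+ y. F y \<partial>M) \<le> c"
proof (cases "c = \<top>")
  case False
  have cc: "inverse c * c = 1"
    using ennreal_divide_self[of c] c False by (simp add: divide_ennreal_def mult.commute less_top)
  have "(\<integral>\<^sup>+ x. inverse c * H x \<partial>M) * (\<integral>\<^sup>+ y. F y \<partial>M) \<le> 1"
  proof (rule two_function_tauD[OF tau])
    fix x y assume "x \<in> space M" "y \<in> space M"
    from mult_left_mono[OF le[OF this], of "inverse c"]
    have "inverse c * H x * F y \<le> K x y * (inverse c * c)"
      by (simp add: mult_ac)
    then show "inverse c * H x * F y \<le> K x y" by (simp add: cc)
  qed auto
  then have "inverse c * ((\<integral>\<^sup>+ x. H x \<partial>M) * (\<integral>\<^sup>+ y. F y \<partial>M)) \<le> 1"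
    by (simp add: nn_integral_cmult mult_ac)
  from mult_left_mono[OF this, of c] show ?thesis
    by (simp add: mult.assoc[symmetric] cc mult.commute[of c])
qed simp

text \<open>For fixed second coordinates \<open>b\<close> and \<open>b'\<close> the inequality on \<open>M\<close> bounds the product of the partial integrals by
\<open>L b b'\<close>; these partial integrals are measurable by Fubini and serve as test functions on \<open>N\<close>.\<close>

lemma two_function_tau_pair:
  assumes "sigma_finite_measure M" "sigma_finite_measure N"
    and tM: "two_function_tau M K" and tN: "two_function_tau N L"
    and L: "\<And>x y. L x y \<noteq> 0"
  shows "two_function_tau (M \<Otimes>\<^sub>M N) (\<lambda>p q. K (fst p) (fst q) * L (snd p) (snd q))"
proof (rule two_function_tauI)
  interpret pair_sigma_finite M N using assms(1,2) by (simp add: pair_sigma_finite_def)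
  fix H F :: "'a \<times> 'b \<Rightarrow> ennreal"
  assume m [measurable]: "H \<in> borel_measurable (M \<Otimes>\<^sub>M N)" "F \<in> borel_measurable (M \<Otimes>\<^sub>M N)"
    and le: "\<And>x y. x \<in> space (M \<Otimes>\<^sub>M N) \<Longrightarrow> y \<in> space (M \<Otimes>\<^sub>M N) \<Longrightarrow>
      H x * F y \<le> K (fst x) (fst y) * L (snd x) (snd y)"
  define H1 where "H1 = (\<lambda>b. \<integral>\<^sup>+ a. H (a, b) \<partial>M)"
  define F1 where "F1 = (\<lambda>b. \<integral>\<^sup>+ a. F (a, b) \<partial>M)"
  have [measurable]: "H1 \<in> borel_measurable N" "F1 \<in> borel_measurable N"
    unfolding H1_def F1_def by measurable
  have "(\<integral>\<^sup>+ b. H1 b \<partial>N) * (\<integral>\<^sup>+ b. F1 b \<partial>N) \<le> 1"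
  proof (rule two_function_tauD[OF tN])
    fix b b' assume b: "b \<in> space N" "b' \<in> space N"
    then show "H1 b * F1 b' \<le> L b b'"
      unfolding H1_def F1_def using le[of "(_, b)" "(_, b')"]
      by (intro two_function_tau_scaled[OF tM _ _ _ L]) (auto simp: space_pair_measure)
  qed auto
  then show "integral\<^sup>N (M \<Otimes>\<^sub>M N) H * integral\<^sup>N (M \<Otimes>\<^sub>M N) F \<le> 1"
    unfolding H1_def F1_def by (simp only: m[THEN nn_integral_snd])
qed

lemma two_function_tau_distr:
  assumes tau: "two_function_tau M K" and [measurable]: "S \<in> measurable M N"
    and le: "\<And>x y. x \<in> space M \<Longrightarrow> y \<in> space M \<Longrightarrow> K' (S x) (S y) \<le> K x y"
  shows "two_function_tau (distr M N S) K'"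
proof (rule two_function_tauI)
  fix H F assume "H \<in> borel_measurable (distr M N S)" "F \<in> borel_measurable (distr M N S)"
    and HF: "\<And>x y. x \<in> space (distr M N S) \<Longrightarrow> y \<in> space (distr M N S) \<Longrightarrow> H x * F y \<le> K' x y"
  then have [measurable]: "H \<in> borel_measurable N" "F \<in> borel_measurable N" by simp_all
  have "(\<integral>\<^sup>+ x. H (S x) \<partial>M) * (\<integral>\<^sup>+ x. F (S x) \<partial>M) \<le> 1"
  proof (rule two_function_tauD[OF tau])
    fix x y assume xy: "x \<in> space M" "y \<in> space M"
    then have "S x \<in> space N" "S y \<in> space N" by (auto intro: measurable_space[OF assms(2)])
    with HF[of "S x" "S y"] le[OF xy] show "H (S x) * F (S y) \<le> K x y"
      by (auto intro: order_trans)
  qed auto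
  then show "integral\<^sup>N (distr M N S) H * integral\<^sup>N (distr M N S) F \<le> 1"
    by (simp add: nn_integral_distr)
qed

lemma two_function_tau_PiM:
  fixes M :: "'i \<Rightarrow> 'a measure"
  assumes "finite I" and ps: "\<And>i. prob_space (M i)"
    and tau: "\<And>i. i \<in> I \<Longrightarrow> two_function_tau (M i) (K i)"
    and K: "\<And>i x y. K i x y \<noteq> 0"
  shows "two_function_tau (PiM I M) (\<lambda>x y. \<Prod>i\<in>I. K i (x i) (y i))"
  using \<open>finite I\<close> tau
proof (induction I rule: finite_induct)
  case empty
  show ?case
  proof (rule two_function_tauI)
    fix H F :: "('i \<Rightarrow> 'a) \<Rightarrow> ennreal"
    assume "\<And>x y. x \<in> space (PiM {} M) \<Longrightarrow> y \<in> space (PiM {} M) \<Longrightarrow> H x * F y \<le> (\<Prod>i\<in>{}. K i (x i) (y i))"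
    from this[of "\<lambda>_. undefined" "\<lambda>_. undefined"]
    show "integral\<^sup>N (PiM {} M) H * integral\<^sup>N (PiM {} M) F \<le> 1"
      by (simp add: PiM_empty nn_integral_count_space_finite)
  qed
next
  case (insert i I)
  interpret product_sigma_finite M
    unfolding product_sigma_finite_def by (simp add: ps prob_space_imp_sigma_finite)
  interpret I: finite_product_sigma_finite M I by standard fact
  have pair: "two_function_tau (M i \<Otimes>\<^sub>M PiM I M)
      (\<lambda>p q. K i (fst p) (fst q) * (\<Prod>j\<in>I. K j (snd p j) (snd q j)))"
    using insert.hyps K
    by (intro two_function_tau_pair insert.IH insert.prems I.sigma_finite_measure_axioms sigma_finite_measures) auto
  have "two_function_tau (distr (M i \<Otimes>\<^sub>M PiM I M) (PiM (insert i I) M) (\<lambda>(x, X). X(i := x)))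
      (\<lambda>x y. \<Prod>j\<in>insert i I. K j (x j) (y j))"
  proof (rule two_function_tau_distr[OF pair])
    fix x y :: "'a \<times> ('i \<Rightarrow> 'a)"
    have "(\<Prod>j\<in>I. K j (((snd x)(i := fst x)) j) (((snd y)(i := fst y)) j))
        = (\<Prod>j\<in>I. K j (snd x j) (snd y j))"
      using insert.hyps by (intro prod.cong) auto
    then show "(\<Prod>j\<in>insert i I. K j ((case x of (x, X) \<Rightarrow> X(i := x)) j) ((case y of (x, X) \<Rightarrow> X(i := x)) j))
        \<le> K i (fst x) (fst y) * (\<Prod>j\<in>I. K j (snd x j) (snd y j))"
      using insert.hyps by (simp add: case_prod_beta)
  qed measurable
  then show ?case
    using distr_pair_PiM_eq_PiM[of I M i] insert.hyps by (simp add: ps)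
qed

text \<open>The integral of a function that may fail to be measurable is a supremum over simple functions below it. Each
such simple function for the completion dominates a function measurable for \<open>M\<close> with the same integral.\<close>

lemma nn_integral_completion_mult_le:
  assumes "\<And>H. H \<in> borel_measurable M \<Longrightarrow> (\<And>x. x \<in> space M \<Longrightarrow> H x \<le> g x) \<Longrightarrow> (\<integral>\<^sup>+ x. H x \<partial>M) * c \<le> 1"
  shows "(\<integral>\<^sup>+ x. g x \<partial>completion M) * c \<le> 1"
proof -
  have "integral\<^sup>S (completion M) s * c \<le> 1" if s: "simple_function (completion M) s" "s \<le> g" for s
  proof -
    have sm: "s \<in> borel_measurable (completion M)"
      using s(1) by (rule borel_measurable_simple_function)
    then obtain s' where s': "s' \<in> borel_measurable M" "AE x in M. s x = s' x"
      using completion_ex_borel_measurable by blast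
    then obtain N where N: "{x \<in> space M. s x \<noteq> s' x} \<subseteq> N" "N \<in> null_sets M"
      unfolding eventually_ae_filter by blast
    \<comment> \<open>set to zero on the exceptional null set, \<open>s'\<close> is a minorant of \<open>s\<close> everywhere\<close>
    define H where "H = (\<lambda>x. s' x * indicator (- N) x)"
    have [measurable]: "N \<in> sets M" using N by auto
    have "integral\<^sup>S (completion M) s = (\<integral>\<^sup>+ x. s x \<partial>completion M)"
      using s(1) by (simp add: nn_integral_eq_simple_integral)
    also have "\<dots> = (\<integral>\<^sup>+ x. s' x \<partial>completion M)"
      using s'(2) by (intro nn_integral_cong_AE AE_completion)
    also have "\<dots> = (\<integral>\<^sup>+ x. s' x \<partial>M)" using s'(1) by (simp add: nn_integral_completion)
    also have "\<dots> = (\<integral>\<^sup>+ x. H x \<partial>M)"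
      using AE_not_in[OF N(2)] unfolding H_def
      by (intro nn_integral_cong_AE) (auto elim!: eventually_mono)
    finally have eq: "integral\<^sup>S (completion M) s = (\<integral>\<^sup>+ x. H x \<partial>M)" .
    have "(\<integral>\<^sup>+ x. H x \<partial>M) * c \<le> 1"
    proof (rule assms)
      show "H \<in> borel_measurable M" unfolding H_def using s'(1) by measurable
      show "H x \<le> g x" if "x \<in> space M" for x
        using N(1) that le_funD[OF s(2), of x] by (auto simp: H_def indicator_def)
    qed
    with eq show ?thesis by simp
  qed
  then show ?thesis
    unfolding nn_integral_def
    by (subst SUP_mult_right_ennreal) (auto intro!: SUP_least)
qed

section \<open>The one-sided exponential measure\<close>

text \<open>Quadratic near the origin and linear at infinity, as a cost for the exponential measure has to be.\<close>

definition cost :: "real \<Rightarrow> real" where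
  "cost d = (sqrt (1 + d\<^sup>2) - 1) / 10"

text \<open>The distance by which the midpoint of \<open>x\<close> and \<open>y\<close> is moved towards the origin when \<open>d = x - y\<close>.\<close>

definition skew :: "real \<Rightarrow> real" where
  "skew d = (sqrt (1 + d\<^sup>2) - 1) / 8"

lemma cost_diff_le: "cost a - cost b \<le> \<bar>a - b\<bar>"
proof -
  have "sqrt (1 + a\<^sup>2) \<le> sqrt (1 + b\<^sup>2) + \<bar>a - b\<bar>"
    using real_sqrt_sum_squares_triangle_ineq[of 1 0 b "a - b"] by simp
  moreover have "(A - 1) / 10 - (B - 1) / 10 \<le> t" if "A \<le> B + t" "0 \<le> t" for A B t :: real
    using that by argo
  ultimately show ?thesis unfolding cost_def using abs_ge_zero by blast
qed

lemma DERIV_skew: "(skew has_real_derivative d / (8 * sqrt (1 + d\<^sup>2))) (at d)"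
proof -
  have "0 < 1 + d\<^sup>2" by (simp add: add_pos_nonneg)
  then show ?thesis
    unfolding skew_def by (auto intro!: derivative_eq_intros simp: field_simps)
qed

text \<open>The trade-off behind both constants: moving the midpoint by \<open>skew d\<close> gains a factor \<open>exp (2 * skew d)\<close> in the
squared density and loses the factor on the right in the squared Jacobian; what is left pays for the cost.
In terms of \<open>R = sqrt (1 + d\<^sup>2)\<close> the claim is \<open>exp (- 3 * (R - 1) / 20) \<le> (15 * R\<^sup>2 + 1) / (16 * R\<^sup>2)\<close>.\<close>

lemma exp_cost_le_skew:
  "exp (cost d - 2 * skew d) \<le> 1 - 4 * (d / (8 * sqrt (1 + d\<^sup>2)))\<^sup>2"
proof -
  define R where "R = sqrt (1 + d\<^sup>2)"
  have R: "1 \<le> R" "R\<^sup>2 = 1 + d\<^sup>2" by (simp_all add: R_def)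
  define c where "c = (3 / 20) * (R - 1)"
  have c: "cost d - 2 * skew d = - c" by (simp add: cost_def skew_def c_def R_def field_simps)
  have "(1 + c) * exp (- c) \<le> exp c * exp (- c)"
    by (intro mult_right_mono exp_ge_add_one_self) auto
  then have "(1 + c) * exp (- c) \<le> 1" by (simp add: exp_minus)
  moreover have "0 \<le> c" using R by (simp add: c_def)
  ultimately have 1: "exp (- c) \<le> 1 / (1 + c)" by (simp add: field_simps)
  have e: "1 - 4 * (d / (8 * R))\<^sup>2 = (15 * R\<^sup>2 + 1) / (16 * R\<^sup>2)"
  proof -
    have "(d / (8 * R))\<^sup>2 = (R\<^sup>2 - 1) / (64 * R\<^sup>2)"
      using R(2) by (simp add: power_divide power_mult_distrib)
    then show ?thesis using R(1) by (simp add: field_simps)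
  qed
  have "16 * R\<^sup>2 \<le> (15 * R\<^sup>2 + 1) * (1 + c)"
  proof -
    have "(15 * R\<^sup>2 + 1) * (1 + c) - 16 * R\<^sup>2 = (R - 1) * ((15 * R\<^sup>2 + 1) * (3/20) - (R + 1))"
      by (simp add: c_def field_simps power2_eq_square)
    moreover have "0 \<le> (15 * R\<^sup>2 + 1) * (3/20) - (R + 1)"
    proof -
      have "R \<le> R\<^sup>2" using R(1) by (simp add: self_le_power)
      then show ?thesis using R(1) unfolding times_divide_eq_right by simp
    qed
    ultimately show ?thesis using R(1) mult_nonneg_nonneg[of "R - 1" "(15 * R\<^sup>2 + 1) * (3/20) - (R + 1)"] by linarith
  qed
  then have 2: "1 / (1 + c) \<le> (15 * R\<^sup>2 + 1) / (16 * R\<^sup>2)"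
  proof -
    have "1 \<le> (15 * R\<^sup>2 + 1) * (1 + c) / (16 * R\<^sup>2)"
      using R(1) \<open>16 * R\<^sup>2 \<le> _\<close> by (subst le_divide_eq_1_pos) auto
    then show ?thesis
      using \<open>0 \<le> c\<close> by (subst pos_divide_le_eq) (auto simp: mult.commute)
  qed
  show ?thesis using 1 2 unfolding c e[unfolded R_def] R_def by linarith
qed

lemma DERIV_inv_of_pos:
  fixes Q :: "real \<Rightarrow> real"
  assumes Q: "\<And>x. (Q has_real_derivative q x) (at x)" and q: "\<And>x. 0 < q x"
  shows "inj Q" "(inv Q has_real_derivative inverse (q y)) (at (Q y))"
proof -
  have "strict_mono Q"
    by (intro strict_monoI) (metis DERIV_pos_imp_increasing Q q)
  then show inj: "inj Q" by (rule strict_mono_imp_inj_on)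
  have "continuous_on UNIV Q"
    using Q by (auto intro!: continuous_at_imp_continuous_on DERIV_isCont)
  then show "(inv Q has_real_derivative inverse (q y)) (at (Q y))"
    using inj Q[of y] q[of y] unfolding has_field_derivative_def
    by (intro has_derivative_inverse_strong[of UNIV y Q "inv Q" "(*) (q y)"])
       (auto simp: fun_eq_iff mult.assoc[symmetric])
qed

text \<open>\<open>P\<close> and \<open>Q\<close> are the distribution functions of the two weighted exponential densities, and \<open>y\<close> transports the
first, on \<open>[0, X]\<close>, to the second, on \<open>[0, Y]\<close>. The point \<open>z x\<close> is the midpoint of \<open>x\<close> and \<open>y x\<close> moved by
\<open>skew\<close>. The exponential mass of \<open>[0, z x]\<close> is \<open>1 - exp (- z x)\<close>; it grows at least as fast as \<open>sqrt c * P x\<close>, and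
being at most \<open>1\<close> it yields \<open>sqrt (P X * Q Y) \<le> 1\<close>.\<close>

lemma exp_transport_interval:
  fixes h f P Q :: "real \<Rightarrow> real"
  assumes P: "\<And>x. (P has_real_derivative exp (h x - x)) (at x)" and P0: "P 0 = 0"
    and Q: "\<And>y. (Q has_real_derivative exp (- f y - y)) (at y)" and Q0: "Q 0 = 0"
    and le: "\<And>x y. h x - f y \<le> cost (x - y)" and XY: "0 < X" "0 < Y"
  shows "P X * Q Y \<le> 1"
proof -
  have mP: "P a < P b" if "a < b" for a b
    using DERIV_pos_imp_increasing[OF that] P exp_gt_zero by metis
  have mQ: "Q a < Q b" if "a < b" for a b
    using DERIV_pos_imp_increasing[OF that] Q exp_gt_zero by metis
  have PX: "0 < P X" and QY: "0 < Q Y" using mP[OF XY(1)] mQ[OF XY(2)] P0 Q0 by auto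
  note inv = DERIV_inv_of_pos[OF Q exp_gt_zero]
  define c where "c = Q Y / P X"
  have c: "0 < c" using PX QY by (simp add: c_def)
  define y where "y x = inv Q (c * P x)" for x
  have Qy: "Q (y x) = c * P x" if "0 \<le> x" "x \<le> X" for x
  proof -
    have "P x \<le> P X" using mP[of x X] that by (cases "x = X") auto
    moreover have "0 \<le> P x" using mP[of 0 x] that P0 by (cases "x = 0") auto
    ultimately have "0 \<le> c * P x" "c * P x \<le> Q Y"
      using c PX QY by (simp_all add: c_def field_simps)
    then have "\<exists>z\<ge>0. z \<le> Y \<and> Q z = c * P x"
      using XY Q0 by (intro IVT) (auto intro: DERIV_isCont[OF Q])
    then have "c * P x \<in> range Q" by (metis rangeI)
    then show ?thesis unfolding y_def by (rule f_inv_into_f)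
  qed
  have y0: "y 0 = 0" using inv(1) Q0 P0 by (simp add: y_def inv_f_eq)
  define z where "z x = (x + y x) / 2 - skew (x - y x)" for x
  have "exp (- z X) + sqrt c * P X \<le> exp (- z 0) + sqrt c * P 0"
  proof (rule DERIV_nonpos_imp_nonincreasing[where f = "\<lambda>x. exp (- z x) + sqrt c * P x" and a = 0 and b = X])
    fix x assume x: "0 \<le> x" "x \<le> X"
    define p where "p = exp (h x - x)"
    define q where "q = exp (- f (y x) - y x)"
    define k where "k = (x - y x) / (8 * sqrt (1 + (x - y x)\<^sup>2))"
    define y' where "y' = c * p / q"
    define z' where "z' = (1 / 2 - k) + (1 / 2 + k) * y'"
    have pos: "0 < p" "0 < q" by (simp_all add: p_def q_def)
    then have y'pos: "0 < y'" using c by (simp add: y'_def)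
    have Dy: "(y has_real_derivative y') (at x)"
    proof -
      have "(inv Q has_real_derivative inverse q) (at (c * P x))"
        using inv(2)[of "y x"] unfolding Qy[OF x] q_def .
      moreover have "((\<lambda>x. c * P x) has_real_derivative c * p) (at x)"
        unfolding p_def by (rule DERIV_cmult[OF P])
      ultimately have "((\<lambda>x. inv Q (c * P x)) has_real_derivative inverse q * (c * p)) (at x)"
        by (rule DERIV_chain2)
      then show ?thesis
        unfolding y_def[abs_def] y'_def by (simp add: divide_inverse mult_ac)
    qed
    have Dz: "(z has_real_derivative z') (at x)"
    proof -
      have "((\<lambda>x. skew (x - y x)) has_real_derivative k * (1 - y')) (at x)"
        unfolding k_def by (rule DERIV_chain2[OF DERIV_skew]) (intro derivative_intros Dy)
      then have "(z has_real_derivative (1 + y') / 2 - k * (1 - y')) (at x)"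
        unfolding z_def[abs_def] by (auto intro!: derivative_eq_intros Dy)
      moreover have "(1 + y') / 2 - k * (1 - y') = z'"
        by (simp add: z'_def field_simps)
      ultimately show ?thesis by simp
    qed
    have kbound: "exp (cost (x - y x) - 2 * skew (x - y x)) \<le> 1 - 4 * k\<^sup>2"
      using exp_cost_le_skew[of "x - y x"] by (simp add: k_def)
    then have "0 < 1 - 4 * k\<^sup>2" by (rule less_le_trans[OF exp_gt_zero])
    then have "(2 * k)\<^sup>2 < 1\<^sup>2" by (simp add: power_mult_distrib)
    then have "\<bar>2 * k\<bar> < 1" using abs_square_less_1[of "2*k"] by simp
    then have k: "0 < 1 / 2 - k" "0 < 1 / 2 + k" by auto
    have z'pos: "0 < z'" 
      unfolding z'_def by (rule add_pos_pos[OF k(1) mult_pos_pos[OF k(2) y'pos]])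
    have "sqrt c * p \<le> exp (- z x) * z'"
    proof (rule power2_le_imp_le)
      have "h x - f (y x) - x - y x \<le> (cost (x - y x) - 2 * skew (x - y x)) + 2 * (- z x)"
        using le[of x "y x"] by (simp add: z_def field_simps)
      then have "p * q \<le> exp (cost (x - y x) - 2 * skew (x - y x)) * exp (2 * (- z x))"
        unfolding p_def q_def by (simp add: exp_add[symmetric] algebra_simps)
      also have "\<dots> \<le> (1 - 4 * k\<^sup>2) * exp (2 * (- z x))"
        using kbound by (intro mult_right_mono) auto
      finally have pq: "p * q \<le> (1 - 4 * k\<^sup>2) * (exp (- z x))\<^sup>2" unfolding exp_double .
      \<comment> \<open>arithmetic-geometric mean inequality for the two summands of \<open>z'\<close>\<close>
      have am: "(1 - 4 * k\<^sup>2) * y' \<le> z'\<^sup>2"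
      proof -
        have "z'\<^sup>2 - (1 - 4 * k\<^sup>2) * y' = ((1 / 2 - k) - (1 / 2 + k) * y')\<^sup>2"
          by (simp add: z'_def power2_eq_square algebra_simps)
        then show ?thesis by (smt (verit) zero_le_power2)
      qed
      have "(sqrt c * p)\<^sup>2 = (p * q) * y'"
        using c pos by (simp add: y'_def power_mult_distrib power2_eq_square)
      also have "\<dots> \<le> (1 - 4 * k\<^sup>2) * (exp (- z x))\<^sup>2 * y'"
        using pq y'pos by (intro mult_right_mono) auto
      also have "\<dots> = (exp (- z x))\<^sup>2 * ((1 - 4 * k\<^sup>2) * y')" by simp
      also have "\<dots> \<le> (exp (- z x))\<^sup>2 * z'\<^sup>2" using am by (intro mult_left_mono) auto
      finally show "(sqrt c * p)\<^sup>2 \<le> (exp (- z x) * z')\<^sup>2" by (simp add: power_mult_distrib)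
      show "0 \<le> exp (- z x) * z'" using z'pos by simp
    qed
    moreover have "((\<lambda>x. exp (- z x) + sqrt c * P x) has_real_derivative
        - (exp (- z x) * z') + sqrt c * p) (at x)"
      unfolding p_def by (auto intro!: derivative_eq_intros Dz P)
    ultimately show "\<exists>D. ((\<lambda>x. exp (- z x) + sqrt c * P x) has_real_derivative D) (at x) \<and> D \<le> 0"
      by (intro exI[of _ "- (exp (- z x) * z') + sqrt c * p"]) auto
  qed (use XY in auto)
  moreover have "z 0 = 0" by (simp add: z_def y0 skew_def)
  ultimately have "exp (- z X) + sqrt c * P X \<le> 1" by (simp add: P0)
  then have "sqrt c * P X \<le> 1"
    using exp_gt_zero[of "- z X"] by linarith
  then have "(sqrt c * P X)\<^sup>2 \<le> 1\<^sup>2" using c PX by (intro power_mono) auto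
  moreover have "(sqrt c * P X)\<^sup>2 = c * (P X * P X)"
    using c by (simp add: power_mult_distrib power2_eq_square[of "P X"])
  moreover have "c * (P X * P X) = P X * Q Y" using PX by (simp add: c_def)
  ultimately show ?thesis by simp
qed

abbreviation exponential_measure :: "real measure" where
  "exponential_measure \<equiv> density lborel (exponential_density 1)"

lemma nn_integral_exponential_measure:
  assumes [measurable]: "g \<in> borel_measurable borel"
  shows "(\<integral>\<^sup>+ x. g x \<partial>exponential_measure) =
    (\<integral>\<^sup>+ x. ennreal (exp (- x)) * g x * indicator {0..} x \<partial>lborel)"
proof -
  have "(\<integral>\<^sup>+ x. g x \<partial>exponential_measure) = (\<integral>\<^sup>+ x. ennreal (exponential_density 1 x) * g x \<partial>lborel)"
    by (subst nn_integral_density) auto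
  also have "\<dots> = (\<integral>\<^sup>+ x. ennreal (exp (- x)) * g x * indicator {0..} x \<partial>lborel)"
    by (intro nn_integral_cong) (auto simp: exponential_density_def indicator_def)
  finally show ?thesis .
qed

lemma continuous_on_imp_antiderivative:
  fixes p :: "real \<Rightarrow> real"
  assumes "continuous_on UNIV p"
  obtains P where "\<And>x. (P has_real_derivative p x) (at x)" "P 0 = 0"
proof -
  have "\<exists>F. \<forall>x::real. (-\<infinity>::ereal) < x \<longrightarrow> x < (\<infinity>::ereal) \<longrightarrow> (F has_vector_derivative p x) (at x)"
    using assms by (intro einterval_antiderivative) (auto simp: continuous_on_eq_continuous_at)
  then obtain F where F: "\<And>x. (F has_real_derivative p x) (at x)"
    by (auto simp: has_real_derivative_iff_has_vector_derivative)
  have "((\<lambda>x. F x - F 0) has_real_derivative p x) (at x)" for x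
    using DERIV_diff[OF F[of x] DERIV_const[of "F 0"]] by simp
  then show ?thesis by (rule that) simp
qed

text \<open>The intervals start at length \<open>1\<close>, so that none of them is degenerate.\<close>

lemma nn_integral_atLeast_SUP:
  fixes g :: "real \<Rightarrow> ennreal"
  assumes [measurable]: "g \<in> borel_measurable borel"
  shows "(\<integral>\<^sup>+ x. g x * indicator {0..} x \<partial>lborel) =
    (SUP n. \<integral>\<^sup>+ x. g x * indicator {0..real (Suc n)} x \<partial>lborel)"
proof -
  have "(\<integral>\<^sup>+ x. g x * indicator {0..} x \<partial>lborel) =
      (\<integral>\<^sup>+ x. (SUP n. g x * indicator {0..real (Suc n)} x) \<partial>lborel)"
  proof (intro nn_integral_cong)
    fix x :: real
    obtain n where n: "x \<le> real (Suc n)"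
      by (meson real_arch_simple le_SucI of_nat_le_iff order_trans)
    show "g x * indicator {0..} x = (SUP n. g x * indicator {0..real (Suc n)} x)"
      using n by (intro antisym SUP_upper2[of n] SUP_least) (auto simp: indicator_def)
  qed
  also have "\<dots> = (SUP n. \<integral>\<^sup>+ x. g x * indicator {0..real (Suc n)} x \<partial>lborel)"
    by (intro nn_integral_monotone_convergence_SUP)
       (auto simp: incseq_def le_fun_def indicator_def)
  finally show ?thesis .
qed

lemma exponential_tau_continuous:
  fixes h f :: "real \<Rightarrow> real"
  assumes h: "continuous_on UNIV h" and f: "continuous_on UNIV f"
    and le: "\<And>x y. h x - f y \<le> cost (x - y)"
  shows "(\<integral>\<^sup>+ x. ennreal (exp (h x)) \<partial>exponential_measure) *
    (\<integral>\<^sup>+ y. ennreal (exp (- f y)) \<partial>exponential_measure) \<le> 1"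
proof -
  have ch: "continuous_on UNIV (\<lambda>x. exp (h x - x))" and cf: "continuous_on UNIV (\<lambda>y. exp (- f y - y))"
    by (intro continuous_intros h f)+
  have [measurable]: "h \<in> borel_measurable borel" "f \<in> borel_measurable borel"
    using h f by (auto intro: borel_measurable_continuous_onI)
  obtain P where P: "\<And>x. (P has_real_derivative exp (h x - x)) (at x)" "P 0 = 0"
    using continuous_on_imp_antiderivative[OF ch] by blast
  obtain Q where Q: "\<And>y. (Q has_real_derivative exp (- f y - y)) (at y)" "Q 0 = 0"
    using continuous_on_imp_antiderivative[OF cf] by blast
  have IP: "(\<integral>\<^sup>+ x. ennreal (exp (h x - x)) * indicator {0..X} x \<partial>lborel) = ennreal (P X)" if "0 \<le> X" for X
    using nn_integral_FTC_Icc[of "\<lambda>x. exp (h x - x)" 0 X P] P that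
    by (auto intro: has_field_derivative_at_within simp: has_real_derivative_iff_has_vector_derivative)
  have IQ: "(\<integral>\<^sup>+ x. ennreal (exp (- f x - x)) * indicator {0..X} x \<partial>lborel) = ennreal (Q X)" if "0 \<le> X" for X
    using nn_integral_FTC_Icc[of "\<lambda>x. exp (- f x - x)" 0 X Q] Q that
    by (auto intro: has_field_derivative_at_within simp: has_real_derivative_iff_has_vector_derivative)
  have "(\<integral>\<^sup>+ x. ennreal (exp (h x)) \<partial>exponential_measure)
      = (\<integral>\<^sup>+ x. ennreal (exp (h x - x)) * indicator {0..} x \<partial>lborel)"
    by (subst nn_integral_exponential_measure)
       (auto simp: ennreal_mult[symmetric] exp_add[symmetric] exp_diff exp_minus divide_inverse mult.commute)
  also have "\<dots> = (SUP n. ennreal (P (real (Suc n))))"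
    by (subst nn_integral_atLeast_SUP) (auto simp: IP simp del: of_nat_Suc)
  finally have 1: "(\<integral>\<^sup>+ x. ennreal (exp (h x)) \<partial>exponential_measure) = \<dots>" .
  have "(\<integral>\<^sup>+ x. ennreal (exp (- f x)) \<partial>exponential_measure)
      = (\<integral>\<^sup>+ x. ennreal (exp (- f x - x)) * indicator {0..} x \<partial>lborel)"
    by (subst nn_integral_exponential_measure)
       (auto simp: ennreal_mult[symmetric] exp_add[symmetric] exp_diff exp_minus divide_inverse mult.commute)
  also have "\<dots> = (SUP n. ennreal (Q (real (Suc n))))"
    by (subst nn_integral_atLeast_SUP) (auto simp: IQ simp del: of_nat_Suc)
  finally have 2: "(\<integral>\<^sup>+ x. ennreal (exp (- f x)) \<partial>exponential_measure) = \<dots>" .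
  show ?thesis
    unfolding 1 2
  proof (subst SUP_mult_right_ennreal, intro SUP_least, subst SUP_mult_left_ennreal, intro SUP_least)
    fix m n
    have "P (real (Suc m)) * Q (real (Suc n)) \<le> 1"
      by (rule exp_transport_interval[OF P Q le]) auto
    moreover have "0 \<le> P (real (Suc m))"
      using DERIV_pos_imp_increasing[of 0 "real (Suc m)" P] P exp_gt_zero
      by (metis less_imp_le of_nat_0_less_iff zero_less_Suc)
    ultimately show "ennreal (P (real (Suc m))) * ennreal (Q (real (Suc n))) \<le> 1"
      by (simp add: ennreal_mult'[symmetric] del: of_nat_Suc)
  qed
qed

text \<open>The test functions are first made regular. Replacing \<open>- ln F\<close> by \<open>f y = sup\<^sub>x (ln (H x) - cost (x - y))\<close>
increases \<open>F\<close>, replacing \<open>ln H\<close> by \<open>h x = inf\<^sub>y (f y + cost (x - y))\<close> increases \<open>H\<close>, the pointwise constraint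
survives, and \<open>h\<close> and \<open>f\<close> inherit a Lipschitz bound from the cost.\<close>

lemma exponential_tau:
  "two_function_tau exponential_measure (\<lambda>x y. ennreal (exp (cost (x - y))))"
proof (rule two_function_tauI)
  fix H F :: "real \<Rightarrow> ennreal"
  assume HF: "\<And>x y. x \<in> space exponential_measure \<Longrightarrow> y \<in> space exponential_measure \<Longrightarrow>
    H x * F y \<le> ennreal (exp (cost (x - y)))"
  then have le: "H x * F y \<le> ennreal (exp (cost (x - y)))" for x y by simp
  show "integral\<^sup>N exponential_measure H * integral\<^sup>N exponential_measure F \<le> 1"
  proof (cases "(\<forall>x. H x = 0) \<or> (\<forall>y. F y = 0)")
    case True
    then have "H = (\<lambda>_. 0) \<or> F = (\<lambda>_. 0)" by (simp add: fun_eq_iff)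
    then show ?thesis by (elim disjE) simp_all
  next
    case False
    then obtain x0 y0 where x0: "H x0 \<noteq> 0" and y0: "F y0 \<noteq> 0" by auto
    have finH: "H x < \<top>" for x
    proof (rule ccontr)
      assume "\<not> ?thesis"
      with le[of x y0] y0 show False by (simp add: less_top[symmetric] ennreal_top_mult top_unique)
    qed
    have finF: "F y < \<top>" for y
    proof (rule ccontr)
      assume "\<not> ?thesis"
      with le[of x0 y] x0 show False by (simp add: less_top[symmetric] ennreal_mult_top top_unique)
    qed
    define a where "a x = ln (enn2real (H x))" for x
    define b where "b y = - ln (enn2real (F y))" for y
    have ea: "H x = ennreal (exp (a x))" if "H x \<noteq> 0" for x
      using finH[of x] that unfolding a_def
      by (subst exp_ln) (auto simp: enn2real_positive_iff zero_less_iff_neq_zero)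
    have eb: "F y = ennreal (exp (- b y))" if "F y \<noteq> 0" for y
      using finF[of y] that unfolding b_def minus_minus
      by (subst exp_ln) (auto simp: enn2real_positive_iff zero_less_iff_neq_zero)
    have ab: "a x - b y \<le> cost (x - y)" if "H x \<noteq> 0" "F y \<noteq> 0" for x y
      using le[of x y] unfolding ea[OF that(1)] eb[OF that(2)]
      by (simp add: ennreal_mult''[symmetric] exp_add[symmetric])
    define f where "f y = (SUP x\<in>{x. H x \<noteq> 0}. a x - cost (x - y))" for y
    have cost_tri: "cost (x - y) - cost (x - z) \<le> \<bar>y - z\<bar>" for x y z
      using cost_diff_le[of "x - y" "x - z"] by (simp add: abs_minus_commute)
    have cost_tri': "cost (x - z) - cost (y - z) \<le> \<bar>x - y\<bar>" for x y z
      using cost_diff_le[of "x - z" "y - z"] by simp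
    have bddf: "bdd_above ((\<lambda>x. a x - cost (x - y)) ` {x. H x \<noteq> 0})" for y
    proof (rule bdd_aboveI2)
      show "a x - cost (x - y) \<le> b y0 + \<bar>y0 - y\<bar>" if "x \<in> {x. H x \<noteq> 0}" for x
        using ab[of x y0] y0 that cost_tri[of x y0 y] by simp
    qed
    have f_ge: "a x - cost (x - y) \<le> f y" if "H x \<noteq> 0" for x y
      unfolding f_def using that by (intro cSUP_upper bddf) auto
    have f_le: "f y \<le> b y" if "F y \<noteq> 0" for y
      unfolding f_def using x0 ab[OF _ that] by (intro cSUP_least) (auto simp: field_simps)
    have f_lip: "f y \<le> f z + \<bar>y - z\<bar>" for y z
      unfolding f_def[of y]
    proof (rule cSUP_least)
      show "a x - cost (x - y) \<le> f z + \<bar>y - z\<bar>" if "x \<in> {x. H x \<noteq> 0}" for x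
        using f_ge[of x z] that cost_tri[of x z y] by (simp add: abs_minus_commute)
    qed (use x0 in auto)
    define h where "h x = (INF y. f y + cost (x - y))" for x
    have bddh: "bdd_below (range (\<lambda>y. f y + cost (x - y)))" for x
    proof (rule bdd_belowI2)
      show "a x0 - \<bar>x0 - x\<bar> \<le> f y + cost (x - y)" for y
        using f_ge[OF x0, of y] cost_tri'[of x0 y x] by simp
    qed
    have h_le: "h x \<le> f y + cost (x - y)" for x y
      unfolding h_def by (intro cINF_lower bddh) auto
    have h_ge: "a x \<le> h x" if "H x \<noteq> 0" for x
      unfolding h_def using f_ge[OF that] by (intro cINF_greatest) (auto simp: field_simps)
    have h_lip: "h x \<le> h z + \<bar>x - z\<bar>" for x z
    proof -
      have "h x - \<bar>x - z\<bar> \<le> h z"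
        unfolding h_def[of z]
      proof (rule cINF_greatest)
        show "h x - \<bar>x - z\<bar> \<le> f y + cost (z - y)" for y
          using h_le[of x y] cost_tri'[of x y z] by simp
      qed auto
      then show ?thesis by simp
    qed
    have lip_cont: "continuous_on UNIV g" if "\<And>x y. g x \<le> g y + \<bar>x - y\<bar>" for g :: "real \<Rightarrow> real"
    proof -
      have "1-lipschitz_on UNIV g"
      proof (rule lipschitz_onI)
        fix x y show "dist (g x) (g y) \<le> 1 * dist x y"
          using that[of x y] that[of y x] by (simp add: dist_real_def abs_le_iff abs_minus_commute)
      qed simp
      then show ?thesis by (rule lipschitz_on_continuous_on)
    qed
    have "integral\<^sup>N exponential_measure H * integral\<^sup>N exponential_measure F \<le>
        (\<integral>\<^sup>+ x. ennreal (exp (h x)) \<partial>exponential_measure) *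
        (\<integral>\<^sup>+ y. ennreal (exp (- f y)) \<partial>exponential_measure)"
    proof (intro mult_mono nn_integral_mono)
      show "H x \<le> ennreal (exp (h x))" for x
        using ea[of x] h_ge[of x] by (cases "H x = 0") auto
      show "F x \<le> ennreal (exp (- f x))" for x
        using eb[of x] f_le[of x] by (cases "F x = 0") auto
    qed auto
    also have "\<dots> \<le> 1"
      using h_le lip_cont[OF f_lip] lip_cont[OF h_lip]
      by (intro exponential_tau_continuous) (auto simp: field_simps)
    finally show ?thesis .
  qed
qed


section \<open>The difference of two exponential variables\<close>

definition laplace_cdf :: "real \<Rightarrow> real" where
  "laplace_cdf t = (if t \<le> 0 then exp t / 2 else 1 - exp (- t) / 2)"

lemma laplace_cdf_bounds: "0 < laplace_cdf t" "laplace_cdf t < 1"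
proof -
  have "0 < laplace_cdf t \<and> laplace_cdf t < 1"
  proof (cases "t \<le> 0")
    case True
    then have "exp t \<le> 1" by simp
    then have "exp t / 2 < 1" by linarith
    with True show ?thesis by (simp add: laplace_cdf_def)
  next
    case False
    then have "exp (- t) \<le> 1" by simp
    then have "exp (- t) < 2" by linarith
    with False show ?thesis by (simp add: laplace_cdf_def)
  qed
  then show "0 < laplace_cdf t" "laplace_cdf t < 1" by auto
qed

lemma prob_space_exponential_measure: "prob_space exponential_measure"
  by (rule prob_space_exponential_density) simp

lemma exponential_measure_atLeast:
  assumes "0 \<le> a"
  shows "emeasure exponential_measure {a..} = ennreal (exp (- a))"
proof -
  have "emeasure exponential_measure {a..} = (\<integral>\<^sup>+ x. indicator {a..} x \<partial>exponential_measure)"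
    by simp
  also have "\<dots> = (\<integral>\<^sup>+ x. ennreal (exp (- x)) * indicator {a..} x * indicator {0..} x \<partial>lborel)"
    by (subst nn_integral_exponential_measure) auto
  also have "\<dots> = (\<integral>\<^sup>+ x. ennreal (exp (- x)) * indicator {a..} x \<partial>lborel)"
    using assms by (intro nn_integral_cong) (auto simp: indicator_def)
  also have "\<dots> = ennreal (0 - (- exp (- a)))"
  proof (rule nn_integral_FTC_atLeast)
    show "((\<lambda>x. - exp (- x)) \<longlongrightarrow> (0::real)) at_top"
      using tendsto_minus[OF filterlim_compose[OF exp_at_bot filterlim_uminus_at_bot_at_top]] by simp
  qed (auto intro!: derivative_eq_intros)
  finally show ?thesis by simp
qed

abbreviation exponential_pair :: "(real \<times> real) measure" where
  "exponential_pair \<equiv> exponential_measure \<Otimes>\<^sub>M exponential_measure"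

lemma exponential_measure_greaterThan:
  assumes "0 \<le> a"
  shows "emeasure exponential_measure {a<..} = ennreal (exp (- a))"
proof -
  have "AE x in exponential_measure. x \<noteq> a"
    using AE_lborel_singleton[of a] by (subst AE_density) (auto elim: eventually_mono)
  then have "emeasure exponential_measure {a<..} = emeasure exponential_measure {a..}"
    by (intro emeasure_eq_AE) (auto elim!: eventually_mono)
  with exponential_measure_atLeast[OF assms] show ?thesis by simp
qed

text \<open>Every event used below has slices over \<open>y \<ge> 0\<close> that are half-lines beyond \<open>t + y\<close>; integrating \<open>exp (- (t + y))\<close>
against the density \<open>exp (- y)\<close> gives half of \<open>exp (- t)\<close>.\<close>

lemma exponential_pair_slices:
  assumes A: "A \<in> sets exponential_pair"
    and slice: "\<And>y. 0 \<le> y \<Longrightarrow>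
      emeasure exponential_measure ((\<lambda>x. (x, y)) -` A) = ennreal (exp (- (t + y)))"
  shows "emeasure exponential_pair A = ennreal (exp (- t) / 2)"
proof -
  interpret E: prob_space exponential_measure by (rule prob_space_exponential_measure)
  interpret pair_prob_space exponential_measure exponential_measure ..
  have "emeasure exponential_pair A =
      (\<integral>\<^sup>+ y. emeasure exponential_measure ((\<lambda>x. (x, y)) -` A) \<partial>exponential_measure)"
    by (rule emeasure_pair_measure_alt2[OF A])
  also have "\<dots> = (\<integral>\<^sup>+ y. ennreal (exp (- y)) *
      emeasure exponential_measure ((\<lambda>x. (x, y)) -` A) * indicator {0..} y \<partial>lborel)"
    using measurable_emeasure_Pair2[OF A] by (intro nn_integral_exponential_measure) simp
  also have "\<dots> = (\<integral>\<^sup>+ y. ennreal (exp (- t - 2 * y)) * indicator {0..} y \<partial>lborel)"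
    by (intro nn_integral_cong)
      (auto simp: indicator_def slice ennreal_mult''[symmetric] exp_add[symmetric])
  also have "\<dots> = ennreal (0 - (- exp (- t - 2 * 0) / 2))"
  proof (rule nn_integral_FTC_atLeast)
    have "((\<lambda>x. - exp (- t - 2 * x) / 2) \<longlongrightarrow> - 0 / 2) at_top"
    proof (intro tendsto_intros filterlim_compose[OF exp_at_bot])
      show "LIM x at_top. - t - 2 * x :> at_bot"
        unfolding filterlim_at_bot
      proof
        fix Z :: real
        show "\<forall>\<^sub>F x in at_top. - t - 2 * x \<le> Z"
          using eventually_ge_at_top[of "(- t - Z) / 2"] by eventually_elim (simp add: field_simps)
      qed
    qed simp
    then show "((\<lambda>x. - exp (- t - 2 * x) / 2) \<longlongrightarrow> 0) at_top" by simp
  qed (auto intro!: derivative_eq_intros)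
  finally show ?thesis by simp
qed

lemma exponential_pair_diff_greater:
  assumes "0 \<le> t"
  shows "emeasure exponential_pair {p. t < fst p - snd p} = ennreal (exp (- t) / 2)"
proof (rule exponential_pair_slices)
  have "{p \<in> space exponential_pair. t < fst p - snd p} \<in> sets exponential_pair" by measurable
  then show "{p. t < fst p - snd p} \<in> sets exponential_pair" by (simp add: space_pair_measure)
  show "emeasure exponential_measure ((\<lambda>x. (x, y)) -` {p. t < fst p - snd p}) = ennreal (exp (- (t + y)))"
    if "0 \<le> y" for y
  proof -
    have "(\<lambda>x. (x, y)) -` {p. t < fst p - snd p} = {t + y<..}" by auto
    then show ?thesis using exponential_measure_greaterThan[of "t + y"] assms that by simp
  qed
qed

lemma exponential_pair_diff_ge:
  assumes "0 \<le> t"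
  shows "emeasure exponential_pair {p. t \<le> fst p - snd p} = ennreal (exp (- t) / 2)"
proof (rule exponential_pair_slices)
  have "{p \<in> space exponential_pair. t \<le> fst p - snd p} \<in> sets exponential_pair" by measurable
  then show "{p. t \<le> fst p - snd p} \<in> sets exponential_pair" by (simp add: space_pair_measure)
  show "emeasure exponential_measure ((\<lambda>x. (x, y)) -` {p. t \<le> fst p - snd p}) = ennreal (exp (- (t + y)))"
    if "0 \<le> y" for y
  proof -
    have "(\<lambda>x. (x, y)) -` {p. t \<le> fst p - snd p} = {t + y..}" by auto
    then show ?thesis using exponential_measure_atLeast[of "t + y"] assms that by simp
  qed
qed

lemma prob_space_exponential_pair: "prob_space exponential_pair"
proof -
  interpret E: prob_space exponential_measure by (rule prob_space_exponential_measure)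
  interpret pair_prob_space exponential_measure exponential_measure ..
  show ?thesis by (rule prob_space_axioms)
qed

lemma exponential_pair_diff_le:
  assumes "0 \<le> t"
  shows "emeasure exponential_pair {p. fst p - snd p \<le> - t} = ennreal (exp (- t) / 2)"
proof -
  interpret E: prob_space exponential_measure by (rule prob_space_exponential_measure)
  interpret pair_prob_space exponential_measure exponential_measure ..
  have "{p \<in> space exponential_pair. fst p - snd p \<le> - t} \<in> sets exponential_pair" by measurable
  then have A: "{p. fst p - snd p \<le> - t} \<in> sets exponential_pair" by (simp add: space_pair_measure)
  have "emeasure exponential_pair {p. fst p - snd p \<le> - t} =
      emeasure (distr exponential_pair exponential_pair (\<lambda>(x, y). (y, x))) {p. fst p - snd p \<le> - t}"
    using distr_pair_swap by simp
  also have "\<dots> = emeasure exponential_pair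
      ((\<lambda>(x, y). (y, x)) -` {p. fst p - snd p \<le> - t} \<inter> space exponential_pair)"
    using A by (intro emeasure_distr measurable_pair_swap')
  also have "(\<lambda>(x, y). (y, x)) -` {p. fst p - snd p \<le> - t} \<inter> space exponential_pair
      = {p. t \<le> fst p - snd p}"
    by (auto simp: space_pair_measure)
  finally show ?thesis using exponential_pair_diff_ge[OF assms] by simp
qed

text \<open>The difference has the Laplace distribution, whose distribution function evaluated at it is uniform on \<open>[0, 1]\<close>.
The two ranges of \<open>c\<close> correspond to the two formulas for \<open>laplace_cdf\<close>.\<close>

lemma exponential_pair_laplace_cdf_uniform:
  assumes "0 \<le> c" "c \<le> 1"
  shows "emeasure exponential_pair {p. laplace_cdf (fst p - snd p) \<le> c} = ennreal c"
proof -
  interpret prob_space exponential_pair by (rule prob_space_exponential_pair)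
  consider "c = 0" | "c = 1" | "0 < c" "c \<le> 1 / 2" | "1 / 2 < c" "c < 1" using assms by linarith
  then show ?thesis
  proof cases
    case 1
    then have "{p. laplace_cdf (fst p - snd p) \<le> c} = {}"
      using laplace_cdf_bounds(1) by (auto simp: not_le)
    with 1 show ?thesis by simp
  next
    case 2
    then have "{p. laplace_cdf (fst p - snd p) \<le> c} = space exponential_pair"
      using laplace_cdf_bounds(2) by (auto simp: space_pair_measure intro: less_imp_le)
    with 2 show ?thesis using emeasure_space_1 by simp
  next
    case 3
    define t where "t = - ln (2 * c)"
    have t: "0 \<le> t" "exp (- t) = 2 * c" using 3 by (simp_all add: t_def)
    have "laplace_cdf s \<le> c \<longleftrightarrow> s \<le> - t" for s
    proof (cases "s \<le> 0")
      case True
      have "exp s / 2 \<le> c \<longleftrightarrow> exp s \<le> exp (- t)" using t by auto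
      with True show ?thesis by (simp add: laplace_cdf_def)
    next
      case False
      then have "exp (- s) < 1" by simp
      then have "c < 1 - exp (- s) / 2" using 3 by linarith
      with False t(1) show ?thesis by (simp add: laplace_cdf_def)
    qed
    with exponential_pair_diff_le[OF t(1)] t(2) show ?thesis by simp
  next
    case 4
    define t where "t = - ln (2 * (1 - c))"
    have t: "0 \<le> t" "exp (- t) = 2 * (1 - c)" using 4 by (simp_all add: t_def)
    have iff: "laplace_cdf s \<le> c \<longleftrightarrow> \<not> t < s" for s
    proof (cases "s \<le> 0")
      case True
      then have "exp s \<le> 1" by simp
      then have "exp s / 2 \<le> c" using 4 by linarith
      with True t(1) show ?thesis by (simp add: laplace_cdf_def)
    next
      case False
      have "1 - exp (- s) / 2 \<le> c \<longleftrightarrow> exp (- t) \<le> exp (- s)" using t by auto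
      with False show ?thesis by (auto simp: laplace_cdf_def)
    qed
    have "{p \<in> space exponential_pair. t < fst p - snd p} \<in> sets exponential_pair" by measurable
    then have A: "{p. t < fst p - snd p} \<in> sets exponential_pair" by (simp add: space_pair_measure)
    have "emeasure exponential_pair {p. laplace_cdf (fst p - snd p) \<le> c} =
        emeasure exponential_pair (space exponential_pair - {p. t < fst p - snd p})"
      by (intro arg_cong[where f = "emeasure exponential_pair"]) (auto simp: iff space_pair_measure)
    also have "\<dots> = ennreal (1 - exp (- t) / 2)"
      using A exponential_pair_diff_greater[OF t(1)]
      by (simp add: emeasure_compl emeasure_space_1 ennreal_minus[symmetric])
    also have "1 - exp (- t) / 2 = c" using t(2) by (simp add: field_simps)
    finally show ?thesis .
  qed
qed

section \<open>The Legendre transform of the log-Laplace transform\<close>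

lemma nn_integral_exp_neq_0:
  fixes u :: "'a::euclidean_space"
  assumes "prob_space M" and M: "sets M = sets borel"
  shows "(\<integral>\<^sup>+ x. ennreal (exp (u \<bullet> x)) \<partial>M) \<noteq> 0"
proof
  interpret prob_space M by fact
  have [measurable_cong]: "sets M = sets borel" by (rule M)
  assume "(\<integral>\<^sup>+ x. ennreal (exp (u \<bullet> x)) \<partial>M) = 0"
  then have "AE x in M. ennreal (exp (u \<bullet> x)) = 0"
    by (subst (asm) nn_integral_0_iff_AE) measurable
  then have "AE x in M. False" by eventually_elim (simp add: ennreal_eq_0_iff not_le)
  then show False by (simp only: AE_const)
qed

text \<open>Exponentiated, the supremum defining the Legendre transform becomes a family of upper bounds by multiples of the
Laplace transform. In this form infinite values need no special care.\<close>

lemma exp_ereal_legendre_le: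
  fixes M :: "'a::euclidean_space measure"
  assumes M: "prob_space M" "sets M = sets borel"
    and le: "\<And>u. ennreal (exp (v \<bullet> u)) \<le> K * (\<integral>\<^sup>+ x. ennreal (exp (u \<bullet> x)) \<partial>M)"
  shows "exp_ereal (legendre_log_laplace M v) \<le> K"
proof (cases K)
  case (real k)
  \<comment> \<open>at \<open>u = 0\<close> the left-hand side is \<open>1\<close>\<close>
  have "K \<noteq> 0" using le[of 0] by auto
  with real have k: "0 < k" by (simp add: ennreal_eq_0_iff)
  have "legendre_log_laplace M v \<le> ereal (ln k)"
    unfolding legendre_log_laplace_def
  proof (rule SUP_least)
    fix u
    define B where "B = (\<integral>\<^sup>+ x. ennreal (exp (u \<bullet> x)) \<partial>M)"
    have B0: "B \<noteq> 0" unfolding B_def by (rule nn_integral_exp_neq_0[OF M])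
    show "ereal (v \<bullet> u) - log_laplace M u \<le> ereal (ln k)"
    proof (cases B)
      case (real b)
      with B0 have b: "0 < b" by (simp add: ennreal_eq_0_iff)
      have "exp (v \<bullet> u) \<le> k * b"
        using le[of u] \<open>K = ennreal k\<close> k b real unfolding B_def[symmetric]
        by (simp add: ennreal_mult[symmetric])
      then have "ln (exp (v \<bullet> u)) \<le> ln (k * b)"
        using k b by (subst ln_le_cancel_iff) auto
      then have "v \<bullet> u - ln b \<le> ln k" using k b by (simp add: ln_mult)
      moreover have "log_laplace M u = ereal (ln b)"
        unfolding log_laplace_def B_def[symmetric] ln_ennreal_def using real b by simp
      ultimately show ?thesis by simp
    next
      case top
      then show ?thesis unfolding log_laplace_def B_def[symmetric] ln_ennreal_def by simp
    qed
  qed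
  then show ?thesis
  proof (cases "legendre_log_laplace M v")
    case (real r)
    with \<open>legendre_log_laplace M v \<le> ereal (ln k)\<close> k have "exp r \<le> k" by (simp add: ln_ge_iff)
    with real \<open>K = ennreal k\<close> show ?thesis by (simp add: exp_ereal_def ennreal_leI)
  qed (auto simp: exp_ereal_def)
qed simp

lemma legendre_nonneg:
  fixes M :: "'a::euclidean_space measure"
  assumes "prob_space M"
  shows "0 \<le> legendre_log_laplace M v"
proof -
  interpret prob_space M by fact
  have "log_laplace M 0 = 0"
    unfolding log_laplace_def ln_ennreal_def by (simp add: emeasure_space_1)
  then have "0 = ereal (v \<bullet> 0) - log_laplace M 0" by simp
  also have "\<dots> \<le> legendre_log_laplace M v"
    unfolding legendre_log_laplace_def by (rule SUP_upper) simp
  finally show ?thesis .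
qed

lemma exp_le_legendre_mult:
  fixes M :: "'a::euclidean_space measure"
  assumes M: "prob_space M" "sets M = sets borel"
  shows "ennreal (exp (v \<bullet> u)) \<le>
    exp_ereal (legendre_log_laplace M v) * (\<integral>\<^sup>+ x. ennreal (exp (u \<bullet> x)) \<partial>M)"
proof -
  define B where "B = (\<integral>\<^sup>+ x. ennreal (exp (u \<bullet> x)) \<partial>M)"
  have B0: "B \<noteq> 0" unfolding B_def by (rule nn_integral_exp_neq_0[OF M])
  have le: "ereal (v \<bullet> u) - log_laplace M u \<le> legendre_log_laplace M v"
    unfolding legendre_log_laplace_def by (rule SUP_upper) simp
  show ?thesis
  proof (cases "legendre_log_laplace M v")
    case (real S)
    show ?thesis
    proof (cases B)
      case (real b)
      with B0 have b: "0 < b" by (simp add: ennreal_eq_0_iff)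
      have "log_laplace M u = ereal (ln b)"
        unfolding log_laplace_def B_def[symmetric] ln_ennreal_def using real b by simp
      with le \<open>legendre_log_laplace M v = ereal S\<close> have "v \<bullet> u \<le> S + ln b" by simp
      then have "exp (v \<bullet> u) \<le> exp (S + ln b)" by simp
      also have "\<dots> = exp S * b" using b by (simp add: exp_add)
      finally show ?thesis
        unfolding B_def[symmetric] using real b \<open>legendre_log_laplace M v = ereal S\<close>
        by (simp add: exp_ereal_def ennreal_mult''[symmetric])
    next
      case top
      then show ?thesis
        unfolding B_def[symmetric] using \<open>legendre_log_laplace M v = ereal S\<close>
        by (simp add: exp_ereal_def ennreal_mult_top ennreal_eq_0_iff)
    qed
  next
    case PInf
    then show ?thesis unfolding B_def[symmetric] using B0 by (simp add: exp_ereal_def ennreal_top_mult)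
  next
    case MInf
    then show ?thesis using legendre_nonneg[OF M(1), of v] by simp
  qed
qed

text \<open>A supremum of continuous functions is lower semicontinuous; arguments \<open>u\<close> at which the log-Laplace
transform is infinite contribute constants.\<close>

lemma borel_measurable_legendre:
  fixes M :: "'a::euclidean_space measure"
  shows "legendre_log_laplace M \<in> borel_measurable borel"
proof (rule borel_measurableI_greater)
  fix y
  have "open {v. y < ereal (v \<bullet> u) - log_laplace M u}" for u
  proof (cases "log_laplace M u")
    case (real r)
    have "continuous_on UNIV (\<lambda>v. ereal (v \<bullet> u - r))" by (intro continuous_intros)
    then have "open ((\<lambda>v. ereal (v \<bullet> u - r)) -` {y<..} \<inter> UNIV)"
      using continuous_on_open_vimage[OF open_UNIV] open_greaterThan by blast
    with real show ?thesis by (simp add: vimage_def)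
  qed auto
  then have "open (\<Union>u. {v. y < ereal (v \<bullet> u) - log_laplace M u})" by blast
  also have "(\<Union>u. {v. y < ereal (v \<bullet> u) - log_laplace M u}) = {v. y < legendre_log_laplace M v}"
    by (auto simp: legendre_log_laplace_def less_SUP_iff)
  finally show "{v \<in> space borel. y < legendre_log_laplace M v} \<in> sets borel" by simp
qed

section \<open>Tails and atoms of a symmetric log-concave measure on the line\<close>

locale symmetric_log_concave = real_distribution M for M +
  assumes sym: "symmetric_measure M" and lc: "log_concave_measure M"
begin

definition tail :: "real \<Rightarrow> real" where
  "tail x = prob {x..}"

lemma prob_uminus: "A \<in> sets borel \<Longrightarrow> prob (uminus ` A) = prob A"
  using sym by (simp add: symmetric_measure_def measure_def)

lemma log_concaveD:
  assumes "compact A" "A \<noteq> {}" "compact B" "B \<noteq> {}" "0 \<le> t" "t \<le> 1"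
  shows "prob A powr t * prob B powr (1 - t) \<le> prob {t * a + (1 - t) * b | a b. a \<in> A \<and> b \<in> B}"
  using lc[unfolded log_concave_measure_def, THEN spec, THEN spec, THEN bspec, THEN mp, of t A B] assms
  by simp

lemma antimono_tail: "x \<le> y \<Longrightarrow> tail y \<le> tail x"
  unfolding tail_def by (intro finite_measure_mono) auto

lemma tail_nonneg: "0 \<le> tail x" by (simp add: tail_def)

text \<open>Half-lines are not compact, so log-concavity is applied to \<open>[x, x + n]\<close> and \<open>[y, y + n]\<close> before letting \<open>n\<close> grow.\<close>

lemma tail_log_concave:
  assumes t: "0 \<le> t" "t \<le> 1"
  shows "tail x powr t * tail y powr (1 - t) \<le> tail (t * x + (1 - t) * y)"
proof (cases "tail x = 0 \<or> tail y = 0")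
  case True
  then show ?thesis by (auto simp: tail_nonneg)
next
  case False
  have lim: "(\<lambda>n. prob {x..x + real n}) \<longlonglongrightarrow> tail x" for x
  proof -
    have "(\<Union>n. {x..x + real n}) = {x..}"
    proof safe
      fix z assume "x \<le> z"
      obtain n where "z - x \<le> real n" using real_arch_simple by blast
      with \<open>x \<le> z\<close> show "z \<in> (\<Union>n. {x..x + real n})" by (auto intro!: exI[of _ n])
    qed simp
    moreover have "(\<lambda>n. prob {x..x + real n}) \<longlonglongrightarrow> prob (\<Union>n. {x..x + real n})"
      by (rule finite_Lim_measure_incseq) (auto simp: incseq_def)
    ultimately show ?thesis by (simp add: tail_def)
  qed
  have "(\<lambda>n. prob {x..x + real n} powr t * prob {y..y + real n} powr (1 - t))
      \<longlonglongrightarrow> tail x powr t * tail y powr (1 - t)"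
    using False by (intro tendsto_mult tendsto_powr lim tendsto_const) auto
  then show ?thesis
  proof (rule LIMSEQ_le_const2, intro exI allI impI)
    fix n :: nat
    have "prob {x..x + real n} powr t * prob {y..y + real n} powr (1 - t)
        \<le> prob {t * a + (1 - t) * b | a b. a \<in> {x..x + real n} \<and> b \<in> {y..y + real n}}"
      using t by (intro log_concaveD) auto
    also have "\<dots> \<le> tail (t * x + (1 - t) * y)"
      unfolding tail_def using t
      by (intro finite_measure_mono) (auto intro!: add_mono mult_left_mono)
    finally show "prob {x..x + real n} powr t * prob {y..y + real n} powr (1 - t)
      \<le> tail (t * x + (1 - t) * y)" .
  qed
qed

text \<open>By symmetry an atom at \<open>p\<close> comes with one of equal mass at \<open>- p\<close>, and log-concavity gives every point between them
at least that mass; but only countably many points can be atoms.\<close>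

lemma prob_singleton_nonzero:
  assumes "p \<noteq> 0"
  shows "prob {p} = 0"
proof (rule ccontr)
  assume "prob {p} \<noteq> 0"
  then have c: "0 < prob {p}" by (simp add: zero_less_measure_iff)
  have cm: "prob {- p} = prob {p}" using prob_uminus[of "{p}"] by simp
  have "(\<lambda>t. (2 * t - 1) * p) ` {0..1} \<subseteq> {x. prob {x} \<noteq> 0}"
  proof safe
    fix t :: real assume t: "t \<in> {0..1}" "prob {(2 * t - 1) * p} = 0"
    have "prob {p} powr t * prob {- p} powr (1 - t) \<le> prob {t * a + (1 - t) * b | a b. a \<in> {p} \<and> b \<in> {- p}}"
      using t by (intro log_concaveD) auto
    also have "{t * a + (1 - t) * b | a b. a \<in> {p} \<and> b \<in> {- p}} = {(2 * t - 1) * p}"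
      by (auto simp: algebra_simps)
    finally have "prob {p} powr t * prob {p} powr (1 - t) \<le> 0" using t cm by simp
    moreover have "prob {p} powr t * prob {p} powr (1 - t) = prob {p}"
      using c by (simp add: powr_add[symmetric])
    ultimately show False using c by simp
  qed
  then have "countable ((\<lambda>t. (2 * t - 1) * p) ` {0..1})"
    using countable_support by (rule countable_subset)
  moreover have "inj_on (\<lambda>t. (2 * t - 1) * p) {0..1}"
    using assms by (auto simp: inj_on_def)
  ultimately have "countable {0..1::real}" by (simp add: countable_image_inj_eq)
  then show False using uncountable_closed_interval[of 0 "1::real"] by simp
qed

text \<open>Suppose that there is an atom at the origin and mass on a compact set \<open>B k\<close> away from it. Log-concavity keeps the
mass of the shrunken sets \<open>(1 - t) B k\<close> bounded below as \<open>t\<close> tends to \<open>1\<close>. These lie in the punctured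
intervals \<open>S n\<close>, whose mass tends to zero.\<close>

lemma prob_zero_cases: "prob {0} = 0 \<or> prob {0} = 1"
proof (rule ccontr)
  assume asm: "\<not> ?thesis"
  then have c: "0 < prob {0}" by (simp add: zero_less_measure_iff)
  define B where "B k = {x. 1 / real (Suc k) \<le> \<bar>x\<bar> \<and> \<bar>x\<bar> \<le> real (Suc k)}" for k
  have cB: "compact (B k)" for k
  proof -
    have "closed (B k)" unfolding B_def
      by (intro closed_Collect_conj closed_Collect_le continuous_intros)
    moreover have "bounded (B k)" unfolding bounded_iff B_def by (auto intro!: exI[of _ "real (Suc k)"])
    ultimately show ?thesis by (simp add: compact_eq_bounded_closed)
  qed
  have "(\<lambda>k. prob (B k)) \<longlonglongrightarrow> prob (\<Union>k. B k)"
  proof (rule finite_Lim_measure_incseq)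
    show "range B \<subseteq> events" using cB by (auto intro: borel_compact)
    show "incseq B"
    proof (rule incseq_SucI)
      show "B n \<le> B (Suc n)" for n
        unfolding B_def using frac_le[of 1 1 "real (Suc n)" "real (Suc (Suc n))"] by auto
    qed
  qed
  moreover have "(\<Union>k. B k) = space M - {0}"
  proof -
    have "x \<in> (\<Union>k. B k)" if "x \<noteq> 0" for x
    proof -
      obtain n where n: "max \<bar>x\<bar> (1 / \<bar>x\<bar>) \<le> real n" using real_arch_simple by blast
      then have "1 / \<bar>x\<bar> \<le> real (Suc n)" by simp
      with that have "1 / real (Suc n) \<le> \<bar>x\<bar>" by (simp add: field_simps)
      with n have "x \<in> B n" by (simp add: B_def)
      then show ?thesis by blast
    qed
    moreover have "0 \<notin> B k" for k by (simp add: B_def)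
    ultimately show ?thesis by auto
  qed
  moreover have "prob (space M - {0}) = 1 - prob {0}" by (rule prob_compl) simp
  ultimately have "(\<lambda>k. prob (B k)) \<longlonglongrightarrow> 1 - prob {0}" by simp
  moreover have "0 < 1 - prob {0}" using asm prob_le_1[of "{0}"] by linarith
  ultimately have "\<forall>\<^sub>F k in sequentially. 0 < prob (B k)" by (rule order_tendstoD(1))
  then obtain k where m: "0 < prob (B k)" by (auto simp: eventually_sequentially)
  then have Bne: "B k \<noteq> {}" by auto
  define S where "S n = {x. 0 < \<bar>x\<bar> \<and> \<bar>x\<bar> \<le> real (Suc k) / real (Suc n)}" for n
  have SM: "S n \<in> sets borel" for n
    unfolding S_def by measurable
  have lower: "min (prob {0}) (prob (B k)) \<le> prob (S n)" for n
  proof -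
    define t where "t = 1 - 1 / real (Suc n)"
    have t: "0 \<le> t" "t \<le> 1" "1 - t = 1 / real (Suc n)" by (auto simp: t_def)
    define e where "e = min (prob {0}) (prob (B k))"
    have e: "0 < e" using c m by (simp add: e_def)
    have "e = e powr t * e powr (1 - t)" using e by (simp add: powr_add[symmetric])
    also have "\<dots> \<le> prob {0} powr t * prob (B k) powr (1 - t)"
      using e t by (intro mult_mono powr_mono2) (auto simp: e_def)
    also have "\<dots> \<le> prob {t * a + (1 - t) * b | a b. a \<in> {0} \<and> b \<in> B k}"
      using t cB Bne by (intro log_concaveD) auto
    also have "\<dots> \<le> prob (S n)"
    proof (rule finite_measure_mono)
      show "{t * a + (1 - t) * b | a b. a \<in> {0} \<and> b \<in> B k} \<subseteq> S n"
      proof safe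
        fix b assume b: "b \<in> B k"
        then have "0 < 1 / real (Suc k)" "1 / real (Suc k) \<le> \<bar>b\<bar>" by (auto simp: B_def)
        then have "0 < \<bar>b\<bar>" by linarith
        then show "t * 0 + (1 - t) * b \<in> S n"
          using b unfolding S_def t(3) B_def by (auto simp: abs_mult divide_right_mono)
      qed
    qed (simp add: SM)
    finally show ?thesis by (simp add: e_def)
  qed
  have "(\<lambda>n. prob (S n)) \<longlonglongrightarrow> prob (\<Inter>n. S n)"
  proof (rule finite_Lim_measure_decseq)
    show "range S \<subseteq> events" using SM by auto
    show "decseq S"
    proof (rule decseq_SucI)
      show "S (Suc n) \<le> S n" for n
        unfolding S_def using frac_le[of "real (Suc k)" "real (Suc k)" "real (Suc n)" "real (Suc (Suc n))"] by auto
    qed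
  qed
  moreover have "(\<Inter>n. S n) = {}"
  proof safe
    fix x :: real assume "x \<in> (\<Inter>n. S n)"
    then have x: "0 < \<bar>x\<bar>" "\<And>n. \<bar>x\<bar> \<le> real (Suc k) / real (Suc n)" by (auto simp: S_def)
    obtain n where n: "real (Suc k) / \<bar>x\<bar> < real n" using reals_Archimedean2 by blast
    have "\<bar>x\<bar> * real (Suc n) \<le> real (Suc k)" using x(2)[of n] by (simp add: field_simps)
    moreover have "real (Suc k) < \<bar>x\<bar> * real n" using n x(1) by (simp add: field_simps)
    ultimately show "x \<in> {}" using x(1) by (simp add: algebra_simps)
  qed
  ultimately have "(\<lambda>n. prob (S n)) \<longlonglongrightarrow> 0" by simp
  from LIMSEQ_le_const[OF this] lower have "min (prob {0}) (prob (B k)) \<le> 0" by blast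
  with c m show False by simp
qed

end

section \<open>Lower bounds for the Laplace transform in terms of tails\<close>

lemma exp_third_le: "exp (1 / 3 :: real) \<le> 3 / 2"
  using exp_bound[of "1 / 3 :: real"] by (simp add: power2_eq_square)

text \<open>The right-hand side is \<open>(cosh b)\<^sup>2 = 1 + (sinh b)\<^sup>2\<close>. For \<open>b \<le> 2\<close> it is compared with \<open>1 + b\<^sup>2\<close>, after the exponent
has been maximised over \<open>u\<close>; for \<open>b > 2\<close> already \<open>exp (2 * b) / 4\<close> is large enough.\<close>

lemma exp_le_cosh_double:
  fixes u b :: real
  assumes u: "0 \<le> u" "u \<le> 1" and b: "0 \<le> b"
  shows "exp (u * b / 4 - (sqrt (1 + u\<^sup>2) - 1) / 5) \<le> (1 + cosh (2 * b)) / 2"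
proof (cases "b \<le> 2")
  case True
  have "(1 + 2 / 5 * u\<^sup>2)\<^sup>2 \<le> 1 + u\<^sup>2"
  proof -
    have "u\<^sup>2 * u\<^sup>2 \<le> u\<^sup>2 * 1" using u by (intro mult_left_mono power_le_one) auto
    moreover have "(1 + 2 / 5 * u\<^sup>2)\<^sup>2 = 1 + 4 / 5 * u\<^sup>2 + 4 / 25 * (u\<^sup>2 * u\<^sup>2)"
      by (simp add: power2_eq_square field_simps)
    ultimately show ?thesis using zero_le_power2[of u] by linarith
  qed
  then have W: "1 + 2 / 5 * u\<^sup>2 \<le> sqrt (1 + u\<^sup>2)" by (rule real_le_rsqrt)
  \<comment> \<open>the square completed for \<open>u * b / 4 - 2 * u\<^sup>2 / 25\<close>\<close>
  have "0 \<le> (2 / 25) * (u - 25 * b / 16)\<^sup>2" by simp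
  also have "\<dots> = 2 / 25 * u\<^sup>2 - u * b / 4 + 25 * b\<^sup>2 / 128"
    by (simp add: power2_eq_square field_simps)
  finally have "u * b / 4 - (sqrt (1 + u\<^sup>2) - 1) / 5 \<le> b\<^sup>2 / 5"
    using W zero_le_power2[of b] by argo
  then have "exp (u * b / 4 - (sqrt (1 + u\<^sup>2) - 1) / 5) \<le> exp (b\<^sup>2 / 5)" by simp
  also have "\<dots> \<le> 1 + b\<^sup>2"
  proof -
    have b4: "b\<^sup>2 \<le> 4" using power_mono[OF True b, of 2] by simp
    then have "exp (b\<^sup>2 / 5) \<le> 1 + b\<^sup>2 / 5 + (b\<^sup>2 / 5)\<^sup>2" by (intro exp_bound) auto
    moreover have "(b\<^sup>2 / 5)\<^sup>2 \<le> b\<^sup>2 / 5 * 1"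
      unfolding power2_eq_square[of "b\<^sup>2 / 5"] using b4 by (intro mult_left_mono) auto
    ultimately show ?thesis using zero_le_power2[of b] by linarith
  qed
  also have "\<dots> \<le> (1 + cosh (2 * b)) / 2"
  proof -
    have "1 + b + b\<^sup>2 / 2 \<le> exp b" by (rule exp_lower_Taylor_quadratic[OF b])
    moreover have "exp (- b) \<le> 1 - b + b\<^sup>2 / 2"
    proof -
      have "(1 - b + b\<^sup>2 / 2) * (1 + b + b\<^sup>2 / 2) = 1 + (b\<^sup>2 / 2)\<^sup>2"
        by (simp add: power2_eq_square field_simps)
      then have "1 \<le> (1 - b + b\<^sup>2 / 2) * (1 + b + b\<^sup>2 / 2)" by simp
      also have "\<dots> \<le> (1 - b + b\<^sup>2 / 2) * exp b"
      proof (intro mult_left_mono exp_lower_Taylor_quadratic b)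
        show "0 \<le> 1 - b + b\<^sup>2 / 2"
          using zero_le_power2[of "1 - b"] by (simp add: power2_diff)
      qed
      finally show ?thesis by (simp add: exp_minus field_simps)
    qed
    ultimately have "b \<le> sinh b" by (simp add: sinh_field_def)
    then have "b\<^sup>2 \<le> (sinh b)\<^sup>2" using b by (intro power_mono) auto
    then show ?thesis by (simp add: cosh_double_cosh cosh_square_eq)
  qed
  finally show ?thesis .
next
  case False
  have "u * b / 4 - (sqrt (1 + u\<^sup>2) - 1) / 5 \<le> b / 4"
  proof -
    have "u * b \<le> 1 * b" using u b by (intro mult_right_mono) auto
    moreover have "1 \<le> sqrt (1 + u\<^sup>2)" by simp
    ultimately show ?thesis by argo
  qed
  then have "exp (u * b / 4 - (sqrt (1 + u\<^sup>2) - 1) / 5) \<le> exp (b / 4)" by simp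
  also have "\<dots> \<le> exp (2 * b) / 4"
  proof -
    have "4 \<le> 1 + 7 * b / 4" using False by simp
    also have "\<dots> \<le> exp (7 * b / 4)" by (rule exp_ge_add_one_self)
    finally have "exp (b / 4) * 4 \<le> exp (b / 4) * exp (7 * b / 4)" by (intro mult_left_mono) auto
    also have "\<dots> = exp (2 * b)" by (simp add: exp_add[symmetric])
    finally show ?thesis by simp
  qed
  also have "\<dots> \<le> (1 + cosh (2 * b)) / 2"
    using exp_gt_zero[of "- (2 * b)"] by (simp add: cosh_field_def field_simps)
  finally show ?thesis .
qed

text \<open>The rate \<open>(sqrt (1 + u\<^sup>2) - 1) / 5\<close> dominates a linear function of slope \<open>1 / 24\<close> as soon as \<open>u \<ge> 1\<close>; \<open>ln 2\<close>
stems from the factor \<open>1 / 2\<close> in a tail of the form \<open>exp (- u) / 2\<close>.\<close>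

lemma linear_le_rate:
  fixes u :: real
  assumes "1 \<le> u"
  shows "(u + ln 2) / 24 \<le> (sqrt (1 + u\<^sup>2) - 1) / 5"
proof -
  have "(1 + 5 * (u + 25 / 36) / 24)\<^sup>2 \<le> 1 + u\<^sup>2"
  proof -
    have "0 \<le> (u - 1) * (u - 1)" by simp
    then show ?thesis using assms by (simp add: power2_eq_square field_simps)
  qed
  then have "1 + 5 * (u + 25 / 36) / 24 \<le> sqrt (1 + u\<^sup>2)" by (rule real_le_rsqrt)
  then show ?thesis using ln2_le_25_over_36 by (simp add: field_simps)
qed

lemma measurable_cosh [measurable]: "(cosh :: real \<Rightarrow> real) \<in> borel_measurable borel"
  by (intro borel_measurable_continuous_onI continuous_on_cosh continuous_on_id)

context symmetric_log_concave
begin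

lemma nn_integral_uminus:
  assumes [measurable]: "g \<in> borel_measurable borel"
  shows "(\<integral>\<^sup>+ x. g (- x) \<partial>M) = (\<integral>\<^sup>+ x. g x \<partial>M)"
proof -
  have "distr M borel uminus = M"
  proof (rule measure_eqI)
    fix A :: "real set" assume "A \<in> sets (distr M borel uminus)"
    then have A [measurable]: "A \<in> sets borel" by simp
    have "emeasure (distr M borel uminus) A = emeasure M (uminus -` A)"
      using A by (subst emeasure_distr) auto
    also have "uminus -` A = uminus ` A"
      by (force simp: image_iff)
    also have "emeasure M \<dots> = emeasure M A" using sym A by (simp add: symmetric_measure_def)
    finally show "emeasure (distr M borel uminus) A = emeasure M A" .
  qed simp
  then have "(\<integral>\<^sup>+ x. g x \<partial>M) = (\<integral>\<^sup>+ x. g x \<partial>distr M borel uminus)" by simp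
  also have "\<dots> = (\<integral>\<^sup>+ x. g (- x) \<partial>M)" by (rule nn_integral_distr) auto
  finally show ?thesis by simp
qed

text \<open>By symmetry the Laplace transform is the integral of \<open>cosh (v * x)\<close>.\<close>

lemma cosh_le_laplace:
  assumes "ennreal c \<le> (\<integral>\<^sup>+ x. ennreal (cosh (v * x)) \<partial>M)"
  shows "ennreal c \<le> (\<integral>\<^sup>+ x. ennreal (exp (v * x)) \<partial>M)"
proof -
  have "2 * (\<integral>\<^sup>+ x. ennreal (cosh (v * x)) \<partial>M) = (\<integral>\<^sup>+ x. 2 * ennreal (cosh (v * x)) \<partial>M)"
    by (rule nn_integral_cmult[symmetric]) simp
  also have "\<dots> = (\<integral>\<^sup>+ x. ennreal (exp (v * x)) + ennreal (exp (v * - x)) \<partial>M)"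
  proof (intro nn_integral_cong)
    fix x
    have "2 * ennreal (cosh (v * x)) = ennreal (2 * cosh (v * x))"
      by (simp add: ennreal_mult')
    also have "2 * cosh (v * x) = exp (v * x) + exp (v * - x)"
      by (simp add: cosh_field_def)
    finally show "2 * ennreal (cosh (v * x)) = ennreal (exp (v * x)) + ennreal (exp (v * - x))"
      by simp
  qed
  also have "\<dots> = (\<integral>\<^sup>+ x. ennreal (exp (v * x)) \<partial>M) + (\<integral>\<^sup>+ x. ennreal (exp (v * - x)) \<partial>M)"
    by (intro nn_integral_add) auto
  also have "(\<integral>\<^sup>+ x. ennreal (exp (v * - x)) \<partial>M) = (\<integral>\<^sup>+ x. ennreal (exp (v * x)) \<partial>M)"
    by (rule nn_integral_uminus) simp
  finally have "2 * (\<integral>\<^sup>+ x. ennreal (cosh (v * x)) \<partial>M) = 2 * (\<integral>\<^sup>+ x. ennreal (exp (v * x)) \<partial>M)"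
    by (simp add: mult_2)
  then have "(\<integral>\<^sup>+ x. ennreal (cosh (v * x)) \<partial>M) = (\<integral>\<^sup>+ x. ennreal (exp (v * x)) \<partial>M)"
    by (simp add: ennreal_mult_cancel_left)
  with assms show ?thesis by simp
qed

lemma one_le_laplace: "1 \<le> (\<integral>\<^sup>+ x. ennreal (exp (v * x)) \<partial>M)"
proof -
  have "ennreal 1 \<le> (\<integral>\<^sup>+ x. ennreal 1 \<partial>M)" using emeasure_space_1 by simp
  also have "\<dots> \<le> (\<integral>\<^sup>+ x. ennreal (cosh (v * x)) \<partial>M)"
    by (intro nn_integral_mono ennreal_leI) (rule cosh_real_ge_1)
  finally show ?thesis using cosh_le_laplace[of 1 v] by simp
qed

lemma exp_mult_tail_le_laplace:
  assumes "0 \<le> v"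
  shows "ennreal (exp (v * z) * tail z) \<le> (\<integral>\<^sup>+ x. ennreal (exp (v * x)) \<partial>M)"
proof -
  have "ennreal (exp (v * z) * tail z) = (\<integral>\<^sup>+ x. ennreal (exp (v * z)) * indicator {z..} x \<partial>M)"
    by (simp add: nn_integral_cmult_indicator tail_def emeasure_eq_measure ennreal_mult')
  also have "\<dots> \<le> (\<integral>\<^sup>+ x. ennreal (exp (v * x)) \<partial>M)"
    using assms by (intro nn_integral_mono) (auto simp: indicator_def intro!: ennreal_leI mult_left_mono)
  finally show ?thesis .
qed

lemma cosh_mult_tail_le_laplace:
  assumes y: "0 < y"
  shows "ennreal (1 + (cosh (v * y) - 1) * (2 * tail y)) \<le> (\<integral>\<^sup>+ x. ennreal (exp (v * x)) \<partial>M)"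
proof (rule cosh_le_laplace)
  let ?c = "cosh (v * y) - 1"
  have c: "0 \<le> ?c" using cosh_real_ge_1[of "v * y"] by simp
  have A: "{x. y \<le> \<bar>x\<bar>} = {y..} \<union> uminus ` {y..}"
    by (auto simp: image_iff abs_if)
  have "prob (uminus ` {y..}) = tail y" using prob_uminus[of "{y..}"] by (simp add: tail_def)
  moreover have "uminus ` {y..} = {..- y}" by auto
  ultimately have "prob {x. y \<le> \<bar>x\<bar>} = 2 * tail y"
    unfolding A using y by (subst finite_measure_Union) (auto simp: tail_def)
  moreover have [measurable]: "{x. y \<le> \<bar>x\<bar>} \<in> sets borel" by measurable
  ultimately have em: "emeasure M {x. y \<le> \<bar>x\<bar>} = ennreal (2 * tail y)"
    by (simp add: emeasure_eq_measure)
  have "ennreal (1 + ?c * (2 * tail y)) = 1 + ennreal ?c * ennreal (2 * tail y)"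
    using c tail_nonneg by (simp add: ennreal_mult)
  also have "\<dots> = (\<integral>\<^sup>+ x. 1 + ennreal ?c * indicator {x. y \<le> \<bar>x\<bar>} x \<partial>M)"
    using emeasure_space_1 by (subst nn_integral_add) (auto simp: nn_integral_cmult em)
  also have "\<dots> \<le> (\<integral>\<^sup>+ x. ennreal (cosh (v * x)) \<partial>M)"
  proof (intro nn_integral_mono)
    fix x
    show "1 + ennreal ?c * indicator {x. y \<le> \<bar>x\<bar>} x \<le> ennreal (cosh (v * x))"
    proof (cases "y \<le> \<bar>x\<bar>")
      case True
      have "cosh (v * y) = cosh (\<bar>v\<bar> * y)" using cosh_real_abs[of "v * y"] y by (simp add: abs_mult)
      also have "\<dots> \<le> cosh (\<bar>v\<bar> * \<bar>x\<bar>)"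
        using True y by (subst cosh_real_nonneg_le_iff) (auto intro!: mult_left_mono)
      also have "\<dots> = cosh (v * x)" using cosh_real_abs[of "v * x"] by (simp add: abs_mult)
      finally have "cosh (v * y) \<le> cosh (v * x)" .
      moreover have "1 + ennreal ?c = ennreal (cosh (v * y))"
        using c by (subst ennreal_1[symmetric], subst ennreal_plus[symmetric]) auto
      ultimately show ?thesis using True by (simp add: ennreal_leI)
    next
      case False
      then show ?thesis using cosh_real_ge_1[of "v * x"] by simp
    qed
  qed
  finally show "ennreal (1 + ?c * (2 * tail y)) \<le> (\<integral>\<^sup>+ x. ennreal (cosh (v * x)) \<partial>M)" .
qed

end

text \<open>Tails are written as \<open>exp (- a) / 2\<close>, so that the tail at the origin has exponent \<open>a = 0\<close>; a geometric mean of tails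
then averages the exponents.\<close>

lemma half_exp_powr:
  "(exp (- a) / 2 :: real) powr t * (exp (- b) / 2) powr (1 - t) = exp (- (t * a + (1 - t) * b)) / 2"
proof -
  have "(exp (- c) / 2 :: real) powr r = exp (r * - (c + ln 2))" for c r
  proof -
    have "(exp (- c) / 2 :: real) = exp (- (c + ln 2))" 
      unfolding minus_add_distrib exp_add by (simp add: exp_minus)
    then show ?thesis by (simp add: exp_powr_real mult.commute)
  qed
  moreover have "exp (- (t * a + (1 - t) * b)) / 2 = exp (- (t * a + (1 - t) * b) - ln 2)"
    by (simp add: exp_diff)
  ultimately show ?thesis by (simp add: exp_add[symmetric] algebra_simps)
qed

context symmetric_log_concave
begin

text \<open>Reflection turns \<open>[- x, \<infinity>)\<close> into \<open>(- \<infinity>, x]\<close>, the complement of \<open>[x, \<infinity>)\<close> up to the massless point \<open>x\<close>.\<close>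

lemma tail_minus:
  assumes atomless: "\<And>x. prob {x} = 0"
  shows "tail (- x) = 1 - tail x"
proof -
  have "tail (- x) = prob (uminus ` {..x})" by (simp add: tail_def)
  also have "\<dots> = prob {..x}" by (rule prob_uminus) simp
  also have "{..x} = insert x (space M - {x..})" by auto
  also have "prob \<dots> = prob {x} + prob (space M - {x..})"
    by (subst finite_measure_Union[symmetric]) auto
  also have "\<dots> = 1 - tail x" using atomless prob_compl[of "{x..}"] by (simp add: tail_def)
  finally show ?thesis .
qed

lemma tail_0:
  assumes atomless: "\<And>x. prob {x} = 0"
  shows "tail 0 = 1 / 2"
  using tail_minus[OF atomless, of 0] by simp

text \<open>With \<open>tail\<close> written as \<open>exp (- m) / 2\<close>, the exponent \<open>m\<close> is convex and vanishes at the origin. Hence its increment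
\<open>s - r\<close> from \<open>y\<close> to \<open>x\<close> is at least \<open>(x - y) / x * s\<close>, whereas at \<open>(x - y) / 2\<close> it is at most half of that.\<close>

lemma tail_half_difference:
  assumes atomless: "\<And>x. prob {x} = 0"
    and "0 < y" "y \<le> x" and x: "tail x = exp (- s) / 2" and y: "tail y = exp (- r) / 2"
  shows "exp (- ((s - r) / 2)) / 2 \<le> tail ((x - y) / 2)"
proof -
  have t0: "tail 0 = exp (- 0) / 2" using tail_0[OF atomless] by simp
  define t where "t = (x - y) / x"
  have t: "0 \<le> t" "t \<le> 1" using assms(2,3) by (auto simp: t_def field_simps)
  have tx: "t * x = x - y" using assms(2,3) by (simp add: t_def)
  have "exp (- ((1 - t) * s)) / 2 \<le> tail ((1 - t) * x)"
    using tail_log_concave[of "1 - t" x 0] half_exp_powr[of s "1 - t" 0] t by (simp add: x t0)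
  also have "(1 - t) * x = y" using tx by (simp add: algebra_simps)
  finally have "r \<le> (1 - t) * s" using y by simp
  then have ts: "t / 2 * s \<le> (s - r) / 2" by (simp add: algebra_simps)
  then have "exp (- ((s - r) / 2)) / 2 \<le> exp (- (t / 2 * s)) / 2" by simp
  also have "\<dots> \<le> tail (t / 2 * x)"
    using tail_log_concave[of "t / 2" x 0] half_exp_powr[of s "t / 2" 0] t by (simp add: x t0)
  also have "t / 2 * x = (x - y) / 2" using tx by simp
  finally show ?thesis .
qed

text \<open>The origin lies between \<open>- y\<close> and \<open>z\<close>, where \<open>y = z / (3 * u)\<close>. Log-concavity at these three points shows that the
tail at \<open>- y\<close> exceeds the tail at the origin by a factor of at most \<open>exp (1 / 3) \<le> 3 / 2\<close>, and by symmetry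
\<open>2 * tail y = 2 - 2 * tail (- y)\<close>.\<close>

lemma tail_ge_quarter:
  assumes atomless: "\<And>x. prob {x} = 0"
    and z: "0 < z" and u: "0 < u" and tz: "exp (- u) / 2 \<le> tail z"
  shows "1 / 2 \<le> 2 * tail (z / (3 * u))"
proof -
  define y where "y = z / (3 * u)"
  have y: "0 < y" using z u by (simp add: y_def)
  have "tail y \<le> 1 / 2" using antimono_tail[of 0 y] y tail_0[OF atomless] by simp
  then have p: "1 \<le> 2 * tail (- y)" using tail_minus[OF atomless, of y] by simp
  define p where "p = ln (2 * tail (- y))"
  have tp: "tail (- y) = exp (- (- p)) / 2" using p by (simp add: p_def)
  define t where "t = y / (y + z)"
  have t: "0 \<le> t" "t \<le> 1" using y z by (auto simp: t_def)
  have t1: "1 - t = z / (y + z)" using y z by (simp add: t_def field_simps)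
  have "exp (- (t * u + (1 - t) * - p)) / 2 = (exp (- u) / 2) powr t * tail (- y) powr (1 - t)"
    using half_exp_powr[of u t "- p"] by (simp add: tp)
  also have "\<dots> \<le> tail z powr t * tail (- y) powr (1 - t)"
    using tz t by (intro mult_right_mono powr_mono2) auto
  also have "\<dots> \<le> tail (t * z + (1 - t) * - y)" by (rule tail_log_concave[OF t])
  also have "t * z + (1 - t) * - y = 0" unfolding t1 by (simp add: t_def)
  finally have "exp (- (t * u + (1 - t) * - p)) \<le> 1" using tail_0[OF atomless] by simp
  then have "(1 - t) * p \<le> t * u" by simp
  then have "z * p \<le> y * u" using y z unfolding t1 unfolding t_def times_divide_eq_left by (simp add: divide_le_cancel)
  then have "p \<le> 1 / 3" using z u by (simp add: y_def field_simps)
  then have "exp p \<le> exp (1 / 3)" by simp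
  also have "\<dots> \<le> 3 / 2" by (rule exp_third_le)
  finally have "2 * tail (- y) \<le> 3 / 2" using tp by simp
  then show ?thesis using tail_minus[OF atomless, of y] by (simp add: y_def)
qed

text \<open>This says \<open>\<Lambda>\<^sup>\<star> (z / 24) \<le> (sqrt (1 + u\<^sup>2) - 1) / 5\<close>. For \<open>u \<ge> 1\<close> it suffices to count the mass beyond \<open>z\<close>, which gives
\<open>\<Lambda> v \<ge> v * z - u - ln 2\<close>. For \<open>u < 1\<close> this bound is too weak because of \<open>ln 2\<close>, and the mass beyond
\<open>z / (3 * u)\<close> is used instead.\<close>

lemma exp_le_rate_mult_laplace:
  assumes atomless: "\<And>x. prob {x} = 0"
    and z: "0 \<le> z" and u: "0 < u" and tz: "exp (- u) / 2 \<le> tail z"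
  shows "ennreal (exp (v * z / 24 - (sqrt (1 + u\<^sup>2) - 1) / 5)) \<le> (\<integral>\<^sup>+ x. ennreal (exp (v * x)) \<partial>M)"
proof (cases "v * z / 24 - (sqrt (1 + u\<^sup>2) - 1) / 5 \<le> 0")
  case True
  then have "ennreal (exp (v * z / 24 - (sqrt (1 + u\<^sup>2) - 1) / 5)) \<le> 1"
    by (simp add: ennreal_le_1)
  then show ?thesis using one_le_laplace by (rule order_trans)
next
  case False
  moreover have "1 \<le> sqrt (1 + u\<^sup>2)" by simp
  ultimately have "0 < v * z" by argo
  then have vz: "0 < v" "0 < z" using z by (auto simp: zero_less_mult_iff)
  show ?thesis
  proof (cases "1 \<le> u")
    case True
    have "exp (v * z / 24 - (sqrt (1 + u\<^sup>2) - 1) / 5) \<le> exp (v * z - u - ln 2)"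
    proof -
      have "v * z / 24 - (sqrt (1 + u\<^sup>2) - 1) / 5 \<le> (v * z - u - ln 2) / 24"
        using linear_le_rate[OF True] by argo
      with False have "v * z / 24 - (sqrt (1 + u\<^sup>2) - 1) / 5 \<le> v * z - u - ln 2" by argo
      then show ?thesis by (rule exp_le_cancel_iff[THEN iffD2])
    qed
    also have "\<dots> = exp (v * z) * (exp (- u) / 2)"
    proof -
      have "v * z - u - ln 2 = (v * z + - u) - ln 2" by simp
      then show ?thesis by (simp only: exp_add exp_diff) simp
    qed
    also have "\<dots> \<le> exp (v * z) * tail z" using tz by (intro mult_left_mono) auto
    finally show ?thesis
      using vz by (intro order_trans[OF ennreal_leI exp_mult_tail_le_laplace]) auto
  next
    case False
    define y where "y = z / (3 * u)"
    define b where "b = v * y / 2"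
    have y: "0 < y" using vz u by (simp add: y_def)
    have b: "0 \<le> b" using vz y by (simp add: b_def)
    have vzb: "v * z / 24 = u * b / 4" using u by (simp add: b_def y_def)
    have "exp (v * z / 24 - (sqrt (1 + u\<^sup>2) - 1) / 5) \<le> (1 + cosh (2 * b)) / 2"
      unfolding vzb using False u b by (intro exp_le_cosh_double) auto
    also have "\<dots> = 1 + (cosh (v * y) - 1) * (1 / 2)" by (simp add: b_def field_simps)
    also have "\<dots> \<le> 1 + (cosh (v * y) - 1) * (2 * tail y)"
      using tail_ge_quarter[OF atomless vz(2) u tz] cosh_real_ge_1[of "v * y"]
      by (intro add_left_mono mult_left_mono) (auto simp: y_def)
    finally show ?thesis
      by (rule order_trans[OF ennreal_leI cosh_mult_tail_le_laplace[OF y]])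
  qed
qed

end

section \<open>Transport from the exponential pair\<close>

text \<open>The triangle inequality for the plane vectors \<open>(1, a)\<close> and \<open>(1, - b)\<close>. Here \<open>a\<close> and \<open>b\<close> are the displacements of the
two exponential variables, so \<open>a - b\<close> is the displacement of their difference.\<close>

lemma rate_le_cost_add: "(sqrt (1 + ((a - b) / 2)\<^sup>2) - 1) / 5 \<le> cost a + cost b"
proof -
  have "sqrt ((1 + 1)\<^sup>2 + (a + - b)\<^sup>2) \<le> sqrt (1\<^sup>2 + a\<^sup>2) + sqrt (1\<^sup>2 + (- b)\<^sup>2)"
    by (rule real_sqrt_sum_squares_triangle_ineq)
  moreover have "sqrt ((1 + 1)\<^sup>2 + (a + - b)\<^sup>2) = 2 * sqrt (1 + ((a - b) / 2)\<^sup>2)"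
  proof -
    have "(1 + 1)\<^sup>2 + (a + - b)\<^sup>2 = 2\<^sup>2 * (1 + ((a - b) / 2)\<^sup>2)"
      by (simp add: power2_eq_square field_simps)
    then have "sqrt ((1 + 1)\<^sup>2 + (a + - b)\<^sup>2) = sqrt (2\<^sup>2) * sqrt (1 + ((a - b) / 2)\<^sup>2)"
      by (simp only: real_sqrt_mult)
    then show ?thesis by simp
  qed
  ultimately have "2 * sqrt (1 + ((a - b) / 2)\<^sup>2) \<le> sqrt (1 + a\<^sup>2) + sqrt (1 + b\<^sup>2)" by simp
  then show ?thesis unfolding cost_def by argo
qed

lemma mono_laplace_cdf: "mono laplace_cdf"
proof (rule monoI)
  fix s t :: real assume st: "s \<le> t"
  show "laplace_cdf s \<le> laplace_cdf t"
  proof (cases "s \<le> 0 \<and> 0 < t")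
    case True
    then have "exp s \<le> 1" "exp (- t) \<le> 1" by simp_all
    then have "exp s / 2 \<le> 1 - exp (- t) / 2" by linarith
    with True show ?thesis by (simp add: laplace_cdf_def)
  next
    case False
    with st show ?thesis by (auto simp: laplace_cdf_def)
  qed
qed

context symmetric_log_concave
begin

sublocale cdf_distribution M ..

text \<open>The quantile function of \<open>M\<close> composed with the Laplace distribution function.\<close>

definition transport :: "real \<Rightarrow> real" where
  "transport t = Inf {x. laplace_cdf t \<le> cdf M x}"

lemma transport_le_iff: "transport t \<le> x \<longleftrightarrow> laplace_cdf t \<le> cdf M x"
  unfolding transport_def by (rule pseudoinverse[symmetric]) (rule laplace_cdf_bounds)+

lemma mono_transport: "mono transport"
proof (rule monoI)
  fix s t :: real assume "s \<le> t"
  then have "laplace_cdf s \<le> laplace_cdf t" using mono_laplace_cdf by (simp add: monoD)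
  also have "\<dots> \<le> cdf M (transport t)" using transport_le_iff[of t "transport t"] by simp
  finally show "transport s \<le> transport t" by (simp add: transport_le_iff)
qed

lemma measurable_transport [measurable]: "transport \<in> borel_measurable borel"
  by (rule borel_measurable_mono[OF mono_transport])

lemma distr_transport: "distr exponential_pair borel (\<lambda>p. transport (fst p - snd p)) = M"
proof (rule cdf_unique)
  interpret P: prob_space exponential_pair by (rule prob_space_exponential_pair)
  have meas [measurable]: "(\<lambda>p. transport (fst p - snd p)) \<in> borel_measurable exponential_pair"
    by measurable
  show "real_distribution (distr exponential_pair borel (\<lambda>p. transport (fst p - snd p)))"
    by (rule P.real_distribution_distr) (rule meas)
  show "real_distribution M" ..
  show "cdf (distr exponential_pair borel (\<lambda>p. transport (fst p - snd p))) = cdf M"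
  proof
    fix x
    have "cdf (distr exponential_pair borel (\<lambda>p. transport (fst p - snd p))) x =
        measure exponential_pair ((\<lambda>p. transport (fst p - snd p)) -` {..x} \<inter> space exponential_pair)"
      unfolding cdf_def by (rule measure_distr) (rule meas, simp)
    also have "(\<lambda>p. transport (fst p - snd p)) -` {..x} \<inter> space exponential_pair
        = {p. laplace_cdf (fst p - snd p) \<le> cdf M x}"
      by (auto simp: transport_le_iff space_pair_measure)
    also have "measure exponential_pair \<dots> = cdf M x"
      unfolding measure_def
      by (subst exponential_pair_laplace_cdf_uniform) (auto simp: cdf_def)
    finally show "cdf (distr exponential_pair borel (\<lambda>p. transport (fst p - snd p))) x = cdf M x" .
  qed
qed

lemma cdf_transport:
  assumes atomless: "\<And>x. prob {x} = 0"
  shows "cdf M (transport t) = laplace_cdf t"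
proof (rule antisym)
  show "laplace_cdf t \<le> cdf M (transport t)" using transport_le_iff[of t "transport t"] by simp
  have "prob {..<transport t} \<le> laplace_cdf t"
  proof (rule tendsto_upperbound[OF cdf_at_left])
    show "\<forall>\<^sub>F x in at_left (transport t). cdf M x \<le> laplace_cdf t"
      using eventually_at_left_real[of "transport t - 1" "transport t"]
    proof (rule eventually_mono)
      show "cdf M x \<le> laplace_cdf t" if "x \<in> {transport t - 1<..<transport t}" for x
        using transport_le_iff[of t x] that by auto
    qed simp
  qed simp
  moreover have "cdf M (transport t) = prob {..<transport t} + prob {transport t}"
  proof -
    have "{..transport t} = {..<transport t} \<union> {transport t}" by auto
    then show ?thesis unfolding cdf_def by (simp only:) (rule finite_measure_Union, auto)
  qed
  ultimately show "cdf M (transport t) \<le> laplace_cdf t" using atomless by simp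
qed

lemma tail_transport:
  assumes atomless: "\<And>x. prob {x} = 0"
  shows "tail (transport t) = 1 - laplace_cdf t"
proof -
  have "cdf M x = tail (- x)" for x
  proof -
    have "tail (- x) = prob (uminus ` {..x})" by (simp add: tail_def)
    also have "\<dots> = prob {..x}" by (rule prob_uminus) simp
    finally show ?thesis by (simp add: cdf_def)
  qed
  then have "tail (transport t) = 1 - cdf M (transport t)"
    using tail_minus[OF atomless, of "transport t"] by simp
  then show ?thesis using cdf_transport[OF atomless] by simp
qed

text \<open>Points on opposite sides of the origin are handled by the midpoint inequality for \<open>transport s\<close> and
\<open>- transport r\<close>; points on the same side by \<open>tail_half_difference\<close>, after a reflection if both are negative.\<close>

lemma tail_half_transport_difference:
  assumes atomless: "\<And>x. prob {x} = 0" and rs: "r < s"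
  shows "exp (- ((s - r) / 2)) / 2 \<le> tail ((transport s - transport r) / 2)"
proof -
  have pos: "tail (transport t) = exp (- t) / 2" if "0 \<le> t" for t
    using that tail_transport[OF atomless, of t] by (cases "t = 0") (auto simp: laplace_cdf_def)
  have neg: "tail (- transport t) = exp t / 2" if "t \<le> 0" for t
    using that tail_transport[OF atomless, of t] tail_minus[OF atomless, of "transport t"]
    by (simp add: laplace_cdf_def)
  have gt0: "0 < x" if "tail x = exp (- t) / 2" "0 < t" for x t
  proof (rule ccontr)
    assume "\<not> 0 < x"
    then have "tail 0 \<le> tail x" by (intro antimono_tail) simp
    then have "1 \<le> exp (- t)" using that tail_0[OF atomless] by simp
    with that show False by simp
  qed
  have le: "transport r \<le> transport s" using rs mono_transport by (simp add: monoD)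
  consider "r \<le> 0" "0 \<le> s" | "0 < r" | "s < 0" by linarith
  then show ?thesis
  proof cases
    case 1
    have "exp (- (1 / 2 * s + (1 - 1 / 2) * - r)) / 2 =
        tail (transport s) powr (1 / 2) * tail (- transport r) powr (1 - 1 / 2)"
      unfolding pos[OF 1(2)] neg[OF 1(1)] using half_exp_powr[of s "1 / 2" "- r"] by simp
    also have "\<dots> \<le> tail (1 / 2 * transport s + (1 - 1 / 2) * - transport r)"
      by (rule tail_log_concave) auto
    finally show ?thesis by (simp add: field_simps)
  next
    case 2
    then show ?thesis
      using rs le pos[of r] pos[of s]
      by (intro tail_half_difference[OF atomless]) (auto intro: gt0)
  next
    case 3
    have "0 < - transport s"
      by (rule gt0[of _ "- s"]) (use 3 neg[of s] in auto)
    with 3 have "exp (- ((- r - - s) / 2)) / 2 \<le> tail ((- transport r - - transport s) / 2)"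
      using rs le neg[of r] neg[of s]
      by (intro tail_half_difference[OF atomless]) auto
    then show ?thesis by simp
  qed
qed

lemma transport_eq_0:
  assumes "prob {0} = 1"
  shows "transport t = 0"
proof (rule antisym)
  have "prob {0} \<le> cdf M 0" unfolding cdf_def by (intro finite_measure_mono) auto
  then show "transport t \<le> 0"
    using assms laplace_cdf_bounds(2)[of t] by (simp add: transport_le_iff)
  show "0 \<le> transport t"
  proof (rule ccontr)
    assume "\<not> 0 \<le> transport t"
    then have "prob {..transport t} \<le> prob (space M - {0})" by (intro finite_measure_mono) auto
    also have "\<dots> = 0" using assms by (subst prob_compl) auto
    finally have "cdf M (transport t) \<le> 0" by (simp add: cdf_def)
    then show False
      using transport_le_iff[of t "transport t"] laplace_cdf_bounds(1)[of t] by simp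
  qed
qed

text \<open>The increment divided by \<open>48\<close> is \<open>\<plusminus> z / 24\<close>, where \<open>z\<close> is half of its absolute value; a negative sign is absorbed
into \<open>v\<close> by symmetry. For the point mass at the origin, and for equal arguments, the increment vanishes, so
the left-hand side is \<open>1\<close>, and both factors on the right are at least \<open>1\<close>.\<close>

lemma exp_transport_difference_le:
  "ennreal (exp (v * ((transport s - transport r) / 48))) \<le>
    ennreal (exp ((sqrt (1 + ((s - r) / 2)\<^sup>2) - 1) / 5)) * (\<integral>\<^sup>+ x. ennreal (exp (v * x)) \<partial>M)"
proof -
  let ?W = "\<lambda>u. (sqrt (1 + u\<^sup>2) - 1) / 5"
  have key: "ennreal (exp (v * ((transport s - transport r) / 48))) \<le>
      ennreal (exp (?W ((s - r) / 2))) * (\<integral>\<^sup>+ x. ennreal (exp (v * x)) \<partial>M)"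
    if atomless: "\<And>x. prob {x} = 0" and "r < s" for r s v
  proof -
    define z where "z = (transport s - transport r) / 2"
    define u where "u = (s - r) / 2"
    have z: "0 \<le> z" using that(2) mono_transport by (simp add: z_def monoD)
    have u: "0 < u" using that(2) by (simp add: u_def)
    have "exp (v * z / 24) = exp (?W u) * exp (v * z / 24 - ?W u)"
      by (simp add: exp_add[symmetric])
    then have "ennreal (exp (v * z / 24)) = ennreal (exp (?W u)) * ennreal (exp (v * z / 24 - ?W u))"
      by (simp add: ennreal_mult)
    also have "\<dots> \<le> ennreal (exp (?W u)) * (\<integral>\<^sup>+ x. ennreal (exp (v * x)) \<partial>M)"
      using exp_le_rate_mult_laplace[OF atomless z u tail_half_transport_difference[OF that, folded z_def u_def]]
      by (rule mult_left_mono) simp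
    also have "v * z / 24 = v * ((transport s - transport r) / 48)" by (simp add: z_def)
    finally show ?thesis by (simp add: u_def)
  qed
  have trivial: ?thesis if "transport s = transport r"
  proof -
    have "1 * 1 \<le> ennreal (exp (?W ((s - r) / 2))) * (\<integral>\<^sup>+ x. ennreal (exp (v * x)) \<partial>M)"
      by (intro mult_mono one_le_laplace) auto
    with that show ?thesis by simp
  qed
  show ?thesis
  proof (cases "prob {0} = 0")
    case True
    then have atomless: "prob {x} = 0" for x using prob_singleton_nonzero by (cases "x = 0") auto
    consider "r < s" | "r = s" | "s < r" by linarith
    then show ?thesis
    proof cases
      case 3
      have "(\<integral>\<^sup>+ x. ennreal (exp (- v * x)) \<partial>M) = (\<integral>\<^sup>+ x. ennreal (exp (v * x)) \<partial>M)"
        using nn_integral_uminus[of "\<lambda>x. ennreal (exp (v * x))"] by simp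
      moreover have "((r - s) / 2)\<^sup>2 = ((s - r) / 2)\<^sup>2" by (simp add: power2_commute power_divide)
      moreover have "- v * ((transport r - transport s) / 48) = v * ((transport s - transport r) / 48)"
        by (simp add: field_simps)
      ultimately show ?thesis using key[OF atomless 3, of "- v"] by simp
    qed (use key[OF atomless] trivial in auto)
  next
    case False
    then have "prob {0} = 1" using prob_zero_cases by blast
    then show ?thesis by (intro trivial) (simp add: transport_eq_0)
  qed
qed

lemma two_function_tau_legendre:
  "two_function_tau M (\<lambda>x y. exp_ereal (legendre_log_laplace M ((x - y) /\<^sub>R 48)))"
proof -
  interpret E: prob_space exponential_measure by (rule prob_space_exponential_measure)
  have "two_function_tau exponential_pair
      (\<lambda>p q. ennreal (exp (cost (fst p - fst q))) * ennreal (exp (cost (snd p - snd q))))"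
    by (intro two_function_tau_pair exponential_tau E.sigma_finite_measure_axioms)
       (simp add: ennreal_eq_0_iff not_le)
  then have "two_function_tau (distr exponential_pair borel (\<lambda>p. transport (fst p - snd p)))
      (\<lambda>x y. exp_ereal (legendre_log_laplace M ((x - y) /\<^sub>R 48)))"
  proof (rule two_function_tau_distr)
    show "(\<lambda>p. transport (fst p - snd p)) \<in> borel_measurable exponential_pair" by measurable
    fix p q :: "real \<times> real"
    define W where "W = (sqrt (1 + (((fst p - snd p) - (fst q - snd q)) / 2)\<^sup>2) - 1) / 5"
    have W: "W \<le> cost (fst p - fst q) + cost (snd p - snd q)"
      using rate_le_cost_add[of "fst p - fst q" "snd p - snd q"] by (simp add: W_def algebra_simps)
    show "exp_ereal (legendre_log_laplace M
        ((transport (fst p - snd p) - transport (fst q - snd q)) /\<^sub>R 48))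
      \<le> ennreal (exp (cost (fst p - fst q))) * ennreal (exp (cost (snd p - snd q)))"
    proof (rule exp_ereal_legendre_le)
      fix v :: real
      have "ennreal (exp (v * ((transport (fst p - snd p) - transport (fst q - snd q)) / 48)))
          \<le> ennreal (exp W) * (\<integral>\<^sup>+ x. ennreal (exp (v * x)) \<partial>M)"
        using exp_transport_difference_le unfolding W_def by simp
      also have "\<dots> \<le> ennreal (exp (cost (fst p - fst q) + cost (snd p - snd q))) *
          (\<integral>\<^sup>+ x. ennreal (exp (v * x)) \<partial>M)"
        using W by (intro mult_right_mono ennreal_leI) auto
      finally show "ennreal (exp (((transport (fst p - snd p) - transport (fst q - snd q)) /\<^sub>R 48) \<bullet> v))
          \<le> ennreal (exp (cost (fst p - fst q))) * ennreal (exp (cost (snd p - snd q))) *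
            (\<integral>\<^sup>+ x. ennreal (exp (v \<bullet> x)) \<partial>M)"
        by (simp add: exp_add ennreal_mult field_simps)
    qed (simp_all add: prob_space_axioms)
  qed
  then show ?thesis by (simp only: distr_transport)
qed

end

section \<open>Product measures\<close>

lemma prod_le_ennreal:
  fixes f g :: "'i \<Rightarrow> ennreal"
  assumes "\<And>i. i \<in> I \<Longrightarrow> f i \<le> g i"
  shows "prod f I \<le> prod g I"
  using assms by (induction I rule: infinite_finite_induct) (auto intro: mult_mono)

context
  fixes \<mu> :: "'n::finite \<Rightarrow> real measure"
  assumes ps: "\<And>i. prob_space (\<mu> i)" and sets_mu: "\<And>i. sets (\<mu> i) = sets borel"
begin

lemma measurable_vec_lambda: "(\<lambda>x. \<chi> i. x i) \<in> PiM UNIV \<mu> \<rightarrow>\<^sub>M (borel :: (real ^ 'n) measure)"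
proof (subst borel_measurable_euclidean_space, intro ballI)
  fix b :: "real ^ 'n" assume "b \<in> Basis"
  then obtain i where b: "b = axis i 1" by (auto simp: Basis_vec_def)
  have "(\<lambda>x. x i) \<in> PiM UNIV \<mu> \<rightarrow>\<^sub>M \<mu> i" by (rule measurable_component_singleton) simp
  then have "(\<lambda>x. x i) \<in> borel_measurable (PiM UNIV \<mu>)"
    by (simp only: measurable_cong_sets[OF refl sets_mu])
  then show "(\<lambda>x. (\<chi> i. x i) \<bullet> b) \<in> borel_measurable (PiM UNIV \<mu>)"
    by (simp add: b inner_axis)
qed

lemma sets_product_measure [simp]: "sets (product_measure \<mu>) = sets borel"
  by (simp add: product_measure_def)

lemma prob_space_product_measure: "prob_space (product_measure \<mu>)"
  unfolding product_measure_def
  by (rule prob_space.prob_space_distr[OF prob_space_PiM[OF ps] measurable_vec_lambda])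

lemma measure_product_measure:
  assumes "\<And>i. A i \<in> sets borel"
  shows "measure (product_measure \<mu>) {x. \<forall>i. x $ i \<in> A i} = (\<Prod>i\<in>UNIV. measure (\<mu> i) (A i))"
proof -
  have "emeasure (\<mu> i) (A i) = ennreal (measure (\<mu> i) (A i))" for i
    using ps[of i] by (simp add: finite_measure.emeasure_eq_measure prob_space.finite_measure)
  then have "emeasure (product_measure \<mu>) {x. \<forall>i. x $ i \<in> A i} = (\<Prod>i\<in>UNIV. ennreal (measure (\<mu> i) (A i)))"
    using emeasure_product_measure[of \<mu> A, OF ps sets_mu assms] by simp
  also have "\<dots> = ennreal (\<Prod>i\<in>UNIV. measure (\<mu> i) (A i))" by (rule prod_ennreal) simp
  finally show ?thesis by (simp add: measure_def prod_nonneg)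
qed

lemma symmetric_marginal:
  assumes "symmetric_measure (product_measure \<mu>)"
  shows "symmetric_measure (\<mu> k)"
  unfolding symmetric_measure_def
proof
  fix A :: "real set" assume A: "A \<in> sets borel"
  have A': "uminus ` A \<in> sets borel"
  proof -
    have "uminus ` A = uminus -` A \<inter> space borel" by (force simp: image_iff)
    also have "\<dots> \<in> sets borel" using A by (intro measurable_sets[where A = borel]) auto
    finally show ?thesis .
  qed
  have marg: "emeasure (product_measure \<mu>) {x. x $ k \<in> B} = emeasure (\<mu> k) B" if B: "B \<in> sets borel" for B
  proof -
    have "{x :: real ^ 'n. x $ k \<in> B} = {x. \<forall>i. x $ i \<in> (if i = k then B else UNIV)}" by auto
    also have "emeasure (product_measure \<mu>) \<dots> = (\<Prod>i\<in>UNIV. emeasure (\<mu> i) (if i = k then B else UNIV))"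
      using B by (intro emeasure_product_measure ps sets_mu) auto
    also have "\<dots> = (\<Prod>i\<in>UNIV. if i = k then emeasure (\<mu> k) B else 1)"
      using prob_space.emeasure_space_1[OF ps] sets_eq_imp_space_eq[OF sets_mu]
      by (intro prod.cong) auto
    finally show ?thesis by simp
  qed
  have "{x :: real ^ 'n. x $ k \<in> A} \<in> sets borel"
    using measurable_sets_borel[OF borel_measurable_nth[of k] A] by (simp add: vimage_def)
  moreover have "{x :: real ^ 'n. x $ k \<in> uminus ` A} = uminus ` {x. x $ k \<in> A}"
    by (force simp: image_iff intro: exI[of _ "- _"])
  ultimately have "emeasure (product_measure \<mu>) {x. x $ k \<in> uminus ` A} = emeasure (product_measure \<mu>) {x. x $ k \<in> A}"
    using assms unfolding symmetric_measure_def by simp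
  then show "emeasure (\<mu> k) (uminus ` A) = emeasure (\<mu> k) A" using marg A A' by simp
qed

lemma ex_interval_pos_measure: "\<exists>n. 0 < measure (\<mu> i) {- real n..real n}"
proof -
  interpret prob_space "\<mu> i" by (rule ps)
  have sp: "space (\<mu> i) = UNIV" using sets_eq_imp_space_eq[OF sets_mu] by simp
  have "(\<lambda>n. prob {- real n..real n}) \<longlonglongrightarrow> prob (\<Union>n. {- real n..real n})"
    by (rule finite_Lim_measure_incseq) (auto simp: incseq_def sets_mu)
  also have "(\<Union>n. {- real n..real n}) = space (\<mu> i)"
  proof -
    have "x \<in> (\<Union>n. {- real n..real n})" for x :: real
    proof -
      obtain n where "\<bar>x\<bar> \<le> real n" using real_arch_simple by blast
      then show ?thesis by (auto simp: abs_le_iff intro!: exI[of _ n])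
    qed
    then show ?thesis by (auto simp: sp)
  qed
  finally have "(\<lambda>n. prob {- real n..real n}) \<longlonglongrightarrow> 1" by (simp only: prob_space)
  then have "\<forall>\<^sub>F n in sequentially. 0 < prob {- real n..real n}" by (rule order_tendstoD(1)) simp
  then show ?thesis by (auto simp: eventually_sequentially)
qed

text \<open>Sets on the line are completed to boxes whose other sides are fixed intervals \<open>J i\<close> of positive mass. These sides
are convex, so a convex combination of two boxes lies in the box over the combination, and their common mass
\<open>\<kappa> = \<kappa> powr t * \<kappa> powr (1 - t)\<close> cancels.\<close>

lemma log_concave_marginal:
  assumes lc: "log_concave_measure (product_measure \<mu>)"
  shows "log_concave_measure (\<mu> k)"
proof -
  obtain N where N: "\<And>i. 0 < measure (\<mu> i) {- real (N i)..real (N i)}"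
    using ex_interval_pos_measure by metis
  define J where "J i = {- real (N i)..real (N i)}" for i
  define box where "box B = {x :: real ^ 'n. \<forall>i. x $ i \<in> (if i = k then B else J i)}" for B
  define \<kappa> where "\<kappa> = (\<Prod>i\<in>UNIV - {k}. measure (\<mu> i) (J i))"
  have \<kappa>: "0 < \<kappa>" unfolding \<kappa>_def J_def using N by (intro prod_pos) auto
  have box: "measure (product_measure \<mu>) (box B) = measure (\<mu> k) B * \<kappa>" if "B \<in> sets borel" for B
  proof -
    have "measure (product_measure \<mu>) (box B) = (\<Prod>i\<in>UNIV. measure (\<mu> i) (if i = k then B else J i))"
      unfolding box_def using that by (intro measure_product_measure) (auto simp: J_def)
    also have "\<dots> = measure (\<mu> k) B * (\<Prod>i\<in>UNIV - {k}. measure (\<mu> i) (if i = k then B else J i))"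
      by (subst prod.remove[of _ k]) auto
    also have "(\<Prod>i\<in>UNIV - {k}. measure (\<mu> i) (if i = k then B else J i)) = \<kappa>"
      unfolding \<kappa>_def by (intro prod.cong) auto
    finally show ?thesis .
  qed
  have compact_box: "compact (box B)" if "compact B" for B
  proof -
    have "closed (box B)"
      unfolding box_def
    proof (intro closed_Collect_all)
      fix i
      have "closed (if i = k then B else J i)" using that by (auto simp: J_def compact_imp_closed)
      then have "closed ((\<lambda>x :: real ^ 'n. x $ i) -` (if i = k then B else J i))"
        by (intro closed_vimage continuous_intros)
      then show "closed {x :: real ^ 'n. x $ i \<in> (if i = k then B else J i)}" by (simp add: vimage_def)
    qed
    moreover have "bounded (box B)"
    proof -
      have "bounded (if i = k then B else J i)" for i using that by (auto simp: J_def compact_imp_bounded)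
      then obtain c where c: "\<And>i x. x \<in> (if i = k then B else J i) \<Longrightarrow> \<bar>x\<bar> \<le> c i"
        unfolding bounded_iff real_norm_def by metis
      have "norm x \<le> (\<Sum>i\<in>UNIV. c i)" if "x \<in> box B" for x
      proof -
        have "norm x \<le> (\<Sum>i\<in>UNIV. \<bar>x $ i\<bar>)" by (rule norm_le_l1_cart)
        also have "\<dots> \<le> (\<Sum>i\<in>UNIV. c i)" using that c unfolding box_def by (intro sum_mono) blast
        finally show ?thesis .
      qed
      then show ?thesis by (auto simp: bounded_iff)
    qed
    ultimately show ?thesis by (simp add: compact_eq_bounded_closed)
  qed
  have box_ne: "box B \<noteq> {}" if "B \<noteq> {}" for B
  proof -
    from that obtain b where "b \<in> B" by auto
    then have "(\<chi> i. if i = k then b else 0) \<in> box B" by (simp add: box_def J_def)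
    then show ?thesis by auto
  qed
  show ?thesis
    unfolding log_concave_measure_def
  proof (intro allI ballI impI)
    fix A B :: "real set" and t :: real
    assume t: "t \<in> {0..1}" and AB: "compact A \<and> A \<noteq> {} \<and> compact B \<and> B \<noteq> {}"
    define C where "C = {t *\<^sub>R a + (1 - t) *\<^sub>R b | a b. a \<in> A \<and> b \<in> B}"
    have cC: "compact C"
    proof -
      have "C = (\<lambda>p. t *\<^sub>R fst p + (1 - t) *\<^sub>R snd p) ` (A \<times> B)"
      proof (intro equalityI subsetI)
        fix x assume "x \<in> C"
        then obtain a b where "a \<in> A" "b \<in> B" "x = t *\<^sub>R a + (1 - t) *\<^sub>R b" unfolding C_def by blast
        then show "x \<in> (\<lambda>p. t *\<^sub>R fst p + (1 - t) *\<^sub>R snd p) ` (A \<times> B)"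
          by (intro image_eqI[of _ _ "(a, b)"]) auto
      next
        fix x assume "x \<in> (\<lambda>p. t *\<^sub>R fst p + (1 - t) *\<^sub>R snd p) ` (A \<times> B)"
        then obtain a b where "a \<in> A" "b \<in> B" "x = t *\<^sub>R a + (1 - t) *\<^sub>R b" by auto
        then show "x \<in> C" unfolding C_def by blast
      qed
      also have "compact \<dots>"
        using AB by (intro compact_continuous_image continuous_intros compact_Times) auto
      finally show ?thesis .
    qed
    have sub: "{t *\<^sub>R a + (1 - t) *\<^sub>R b | a b. a \<in> box A \<and> b \<in> box B} \<subseteq> box C"
    proof safe
      fix a b assume ab: "a \<in> box A" "b \<in> box B"
      have "(t *\<^sub>R a + (1 - t) *\<^sub>R b) $ i \<in> (if i = k then C else J i)" for i
      proof (cases "i = k")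
        case True
        have "a $ k \<in> A" "b $ k \<in> B"
          using ab[unfolded box_def mem_Collect_eq, THEN spec, of k] by simp_all
        then have "t *\<^sub>R (a $ k) + (1 - t) *\<^sub>R (b $ k) \<in> C" unfolding C_def by blast
        with True show ?thesis by simp
      next
        case False
        then have "a $ i \<in> J i" "b $ i \<in> J i"
          using ab[unfolded box_def mem_Collect_eq, THEN spec, of i] by simp_all
        moreover have "convex (J i)" by (simp add: J_def)
        ultimately have "t *\<^sub>R (a $ i) + (1 - t) *\<^sub>R (b $ i) \<in> J i" using t by (intro convexD) auto
        with False show ?thesis by simp
      qed
      then show "t *\<^sub>R a + (1 - t) *\<^sub>R b \<in> box C" by (simp add: box_def)
    qed
    interpret P: prob_space "product_measure \<mu>" by (rule prob_space_product_measure)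
    have "(measure (\<mu> k) A * \<kappa>) powr t * (measure (\<mu> k) B * \<kappa>) powr (1 - t) =
        measure (product_measure \<mu>) (box A) powr t * measure (product_measure \<mu>) (box B) powr (1 - t)"
      using AB by (simp add: box borel_compact)
    also have "\<dots> \<le> measure (product_measure \<mu>) {t *\<^sub>R a + (1 - t) *\<^sub>R b | a b. a \<in> box A \<and> b \<in> box B}"
      using lc[unfolded log_concave_measure_def, THEN spec, THEN spec, THEN bspec, THEN mp, of t "box A" "box B"]
        t AB compact_box box_ne by blast
    also have "\<dots> \<le> measure (product_measure \<mu>) (box C)"
      using sub compact_box[OF cC] by (intro P.finite_measure_mono) (auto intro: borel_compact)
    also have "\<dots> = measure (\<mu> k) C * \<kappa>" using cC by (simp add: box borel_compact)
    also have "(measure (\<mu> k) A * \<kappa>) powr t * (measure (\<mu> k) B * \<kappa>) powr (1 - t) =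
        (measure (\<mu> k) A powr t * measure (\<mu> k) B powr (1 - t)) * (\<kappa> powr t * \<kappa> powr (1 - t))"
      using \<kappa> by (simp add: powr_mult)
    also have "\<kappa> powr t * \<kappa> powr (1 - t) = \<kappa>" using \<kappa> by (simp add: powr_add[symmetric])
    finally show "measure (\<mu> k) A powr t * measure (\<mu> k) B powr (1 - t)
        \<le> measure (\<mu> k) {t *\<^sub>R a + (1 - t) *\<^sub>R b | a b. a \<in> A \<and> b \<in> B}"
      using \<kappa> by (simp add: C_def)
  qed
qed

lemma laplace_product_measure:
  "(\<integral>\<^sup>+ x. ennreal (exp (u \<bullet> x)) \<partial>product_measure \<mu>) =
    (\<Prod>i\<in>UNIV. \<integral>\<^sup>+ x. ennreal (exp (u $ i \<bullet> x)) \<partial>\<mu> i)"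
proof -
  interpret product_sigma_finite \<mu>
    unfolding product_sigma_finite_def by (simp add: ps prob_space_imp_sigma_finite)
  have "(\<integral>\<^sup>+ x. ennreal (exp (u \<bullet> x)) \<partial>product_measure \<mu>) =
      (\<integral>\<^sup>+ x. ennreal (exp (u \<bullet> (\<chi> i. x i))) \<partial>PiM UNIV \<mu>)"
    unfolding product_measure_def by (rule nn_integral_distr[OF measurable_vec_lambda]) simp
  also have "\<dots> = (\<integral>\<^sup>+ x. (\<Prod>i\<in>UNIV. ennreal (exp (u $ i \<bullet> x i))) \<partial>PiM UNIV \<mu>)"
    by (intro nn_integral_cong) (simp add: inner_vec_def exp_sum prod_ennreal)
  also have "\<dots> = (\<Prod>i\<in>UNIV. \<integral>\<^sup>+ x. ennreal (exp (u $ i \<bullet> x)) \<partial>\<mu> i)"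
  proof (rule product_nn_integral_prod)
    show "(\<lambda>x. ennreal (exp (u $ i \<bullet> x))) \<in> borel_measurable (\<mu> i)" for i
      unfolding measurable_cong_sets[OF sets_mu refl] by measurable
  qed simp
  finally show ?thesis .
qed

text \<open>The Laplace transform of a product measure factorises, so the upper bounds that characterise the factors multiply.\<close>

lemma exp_legendre_product_le:
  "exp_ereal (legendre_log_laplace (product_measure \<mu>) v)
    \<le> (\<Prod>i\<in>UNIV. exp_ereal (legendre_log_laplace (\<mu> i) (v $ i)))"
proof (rule exp_ereal_legendre_le[OF prob_space_product_measure sets_product_measure])
  fix u :: "real ^ 'n"
  have "ennreal (exp (v \<bullet> u)) = (\<Prod>i\<in>UNIV. ennreal (exp (v $ i \<bullet> u $ i)))"
    by (simp add: inner_vec_def exp_sum prod_ennreal)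
  also have "\<dots> \<le> (\<Prod>i\<in>UNIV. exp_ereal (legendre_log_laplace (\<mu> i) (v $ i)) *
      (\<integral>\<^sup>+ x. ennreal (exp (u $ i \<bullet> x)) \<partial>\<mu> i))"
    by (intro prod_le_ennreal exp_le_legendre_mult ps sets_mu)
  also have "\<dots> = (\<Prod>i\<in>UNIV. exp_ereal (legendre_log_laplace (\<mu> i) (v $ i))) *
      (\<integral>\<^sup>+ x. ennreal (exp (u \<bullet> x)) \<partial>product_measure \<mu>)"
    by (simp add: prod.distrib laplace_product_measure)
  finally show "ennreal (exp (v \<bullet> u)) \<le> \<dots>" .
qed

end

lemma exp_ereal_neq_0: "0 \<le> x \<Longrightarrow> exp_ereal x \<noteq> 0"
  by (cases x) (auto simp: exp_ereal_def ennreal_eq_0_iff not_le)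

text \<open>Any measurable minorant of the exponentiated infimum convolution satisfies the pointwise constraint with
\<open>exp (- f)\<close>, since the infimum at \<open>x\<close> is at most its entry at \<open>x - y\<close>.\<close>

lemma property_tau_two_function:
  assumes M: "prob_space M" "sets M = sets borel"
    and \<phi>: "\<phi> \<in> borel_measurable borel" "\<And>x. 0 \<le> \<phi> x"
    and tau: "two_function_tau M (\<lambda>x y. exp_ereal (\<phi> (x - y)))"
  shows "property_tau M \<phi>"
  unfolding property_tau_def
proof (intro conjI allI impI M \<phi>)
  fix f :: "'a \<Rightarrow> real"
  assume "f \<in> borel_measurable borel \<and> bounded (range f)"
  then have [measurable]: "f \<in> borel_measurable borel" by simp
  show "(\<integral>\<^sup>+ x. exp_ereal (inf_convolution (\<lambda>y. ereal (f y)) \<phi> x) \<partial>completion M) *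
      (\<integral>\<^sup>+ x. ennreal (exp (- f x)) \<partial>M) \<le> 1"
  proof (rule nn_integral_completion_mult_le)
    fix H assume H: "H \<in> borel_measurable M"
      and le: "\<And>x. x \<in> space M \<Longrightarrow> H x \<le> exp_ereal (inf_convolution (\<lambda>y. ereal (f y)) \<phi> x)"
    show "(\<integral>\<^sup>+ x. H x \<partial>M) * (\<integral>\<^sup>+ x. ennreal (exp (- f x)) \<partial>M) \<le> 1"
    proof (rule two_function_tauD[OF tau H])
      show "(\<lambda>x. ennreal (exp (- f x))) \<in> borel_measurable M"
        unfolding measurable_cong_sets[OF M(2) refl] by measurable
      fix x y assume x: "x \<in> space M"
      have inf: "inf_convolution (\<lambda>y. ereal (f y)) \<phi> x \<le> ereal (f y) + \<phi> (x - y)"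
        unfolding inf_convolution_def by (rule INF_lower2[of "x - y"]) simp_all
      have mono: "exp_ereal a \<le> exp_ereal b" if "a \<le> b" for a b
        using that by (cases a; cases b) (auto simp: exp_ereal_def intro: ennreal_leI)
      have "H x \<le> exp_ereal (ereal (f y) + \<phi> (x - y))"
        using le[OF x] mono[OF inf] by (rule order_trans)
      then have "H x * ennreal (exp (- f y)) \<le> exp_ereal (ereal (f y) + \<phi> (x - y)) * ennreal (exp (- f y))"
        by (intro mult_right_mono) auto
      also have "\<dots> = exp_ereal (\<phi> (x - y))"
        using \<phi>(2)[of "x - y"]
        by (cases "\<phi> (x - y)")
           (auto simp: exp_ereal_def ennreal_mult[symmetric] exp_add[symmetric] ennreal_top_mult ennreal_eq_0_iff not_le)
      finally show "H x * ennreal (exp (- f y)) \<le> exp_ereal (\<phi> (x - y))" .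
    qed
  qed
qed

theorem corollary2p19:
  fixes \<mu> :: "'n::finite \<Rightarrow> real measure"
  assumes "\<And>i. prob_space (\<mu> i)"
    and "\<And>i. sets (\<mu> i) = sets borel"
    and "symmetric_measure (product_measure \<mu>)"
    and "log_concave_measure (product_measure \<mu>)"
  shows "IC (product_measure \<mu>) 48"
proof -
  note ps = assms(1) and sets_mu = assms(2)
  let ?\<Lambda> = "\<lambda>M v. legendre_log_laplace M (v /\<^sub>R 48)"
  have one_dim: "two_function_tau (\<mu> i) (\<lambda>x y. exp_ereal (?\<Lambda> (\<mu> i) (x - y)))" for i
  proof -
    interpret prob_space "\<mu> i" by (rule ps)
    interpret symmetric_log_concave "\<mu> i"
      by unfold_locales
         (use sets_mu symmetric_marginal[OF ps sets_mu assms(3)] log_concave_marginal[OF ps sets_mu assms(4)] in auto)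
    show ?thesis by (rule two_function_tau_legendre)
  qed
  have "two_function_tau (PiM UNIV \<mu>) (\<lambda>x y. \<Prod>i\<in>UNIV. exp_ereal (?\<Lambda> (\<mu> i) (x i - y i)))"
    by (intro two_function_tau_PiM ps one_dim exp_ereal_neq_0 legendre_nonneg) simp
  then have "two_function_tau (product_measure \<mu>) (\<lambda>x y. exp_ereal (?\<Lambda> (product_measure \<mu>) (x - y)))"
    unfolding product_measure_def
  proof (rule two_function_tau_distr[OF _ measurable_vec_lambda[OF ps sets_mu]])
    fix x y :: "'n \<Rightarrow> real"
    show "exp_ereal (?\<Lambda> (distr (PiM UNIV \<mu>) borel (\<lambda>x. \<chi> i. x i)) ((\<chi> i. x i) - (\<chi> i. y i)))
        \<le> (\<Prod>i\<in>UNIV. exp_ereal (?\<Lambda> (\<mu> i) (x i - y i)))"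
      using exp_legendre_product_le[OF ps sets_mu, where v = "((\<chi> i. x i) - (\<chi> i. y i)) /\<^sub>R 48"]
      by (simp add: product_measure_def)
  qed
  moreover have "(\<lambda>v. ?\<Lambda> (product_measure \<mu>) v) \<in> borel_measurable borel"
    by (rule measurable_compose[OF _ borel_measurable_legendre]) measurable
  ultimately have "property_tau (product_measure \<mu>) (?\<Lambda> (product_measure \<mu>))"
    by (intro property_tau_two_function prob_space_product_measure sets_product_measure legendre_nonneg ps sets_mu)
  then show ?thesis unfolding IC_def using assms(3) by simp
qed

end
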